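(* Let $W$ be the Coxeter versor of the root system $D_6$, i.e. the product in $\mathrm{Cl}(6)$ of its six simple roots normalised to unit length. Then $W$ can be written as $$W=\exp\!\left(\tfrac{\pi}{10}B_C\right)\exp\!\left(\tfrac{3\pi}{10}B_2\right)B_3$$ where $B_C$, $B_2$, $B_3$ are unit bivectors of three mutually orthogonal planes in $\mathbb{R}^6$ and $B_C$ is the bivector of the Coxeter plane. In particular the exponents of $D_6$ are $\{1,3,5,5,7,9\}$.
   Context: $\mathrm{Cl}(6)$ is the real Clifford algebra generated by orthonormal vectors $e_1,\dots,e_6$ of $\mathbb{R}^6$ with $e_i^2=1$, $e_ie_j=-e_je_i$ for $i\ne j$. The tilde denotes reversal of the order of vector factors. The Coxeter element $w$ is the product of the simple reflections $s_\alpha v=-\alpha v\alpha$ and is given by $wv=\tilde WvW$. Its order is the Coxeter number $h=10$, and its complex eigenvalues are $\exp(2\pi i m/h)$, where the integers $m$ with $0<m<h$ (with multiplicity) are the exponents. The Coxeter plane is the plane on which $w$ acts as a rotation by $2\pi/h$. The unit bivector of a plane with orthonormal basis $u,v$ is $uv$ (squaring to $-1$), with either choice of orientation; bivectors of orthogonal planes commute. $\exp(\theta B)=\cos\theta+B\sin\theta$ for a unit bivector $B$. *)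

theory Defs
  imports
    "HOL-Analysis.Analysis"
    "HOL-Computational_Algebra.Polynomial"
    "HOL-Library.Multiset"
begin

section \<open>The real Clifford algebra of Euclidean space\<close>

text \<open>
  An element is given by its coefficients with respect to the basis of increasing products
  of generators, indexed by the sets of generators involved. The order on the index type
  only fixes the ordering of the factors in these basis elements.
\<close>

typedef 'n clifford = "UNIV :: ('n set \<Rightarrow> real) set"
  morphisms coeff_at Clifford
  by simp

lemma coeff_at_Clifford [simp]: "coeff_at (Clifford f) = f"
  by (simp add: Clifford_inverse)

lemma clifford_eqI: "(\<And>A. coeff_at x A = coeff_at y A) \<Longrightarrow> x = y"
  by (metis coeff_at_inject ext)

text \<open>
  Sorting the concatenation of the increasing products over \<open>A\<close> and \<open>B\<close> costs one sign for
  each pair in the wrong order; repeated generators then cancel, as they square to \<open>1\<close>.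
\<close>

definition reorder_sign :: "'n::{finite,linorder} set \<Rightarrow> 'n set \<Rightarrow> real" where
  "reorder_sign A B = (\<Prod>a\<in>A. \<Prod>b\<in>B. if b < a then -1 else 1)"

lemma prod_sym_diff:
  fixes f :: "'a::finite \<Rightarrow> real"
  assumes "\<And>a. f a * f a = 1"
  shows "prod f (sym_diff A B) = prod f A * prod f B"
proof -
  have A: "prod f A = prod f (A - B) * prod f (A \<inter> B)"
    by (subst prod.union_disjoint[symmetric]) (auto intro: prod.cong)
  have B: "prod f B = prod f (B - A) * prod f (A \<inter> B)"
    by (subst prod.union_disjoint[symmetric]) (auto intro: prod.cong)
  have sq: "prod f (A \<inter> B) * prod f (A \<inter> B) = 1"
    using assms by (simp flip: prod.distrib)
  have "prod f (sym_diff A B) = prod f (A - B) * prod f (B - A)"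
    by (rule prod.union_disjoint) auto
  also have "\<dots> = prod f (A - B) * prod f (B - A) * (prod f (A \<inter> B) * prod f (A \<inter> B))"
    using sq by simp
  also have "\<dots> = prod f A * prod f B"
    unfolding A B by (simp only: ac_simps)
  finally show ?thesis .
qed

lemma reorder_sign_empty [simp]: "reorder_sign {} B = 1" "reorder_sign A {} = 1"
  by (simp_all add: reorder_sign_def)

lemma reorder_sign_sym_diff_left:
  "reorder_sign (sym_diff A B) C = reorder_sign A C * reorder_sign B C"
  unfolding reorder_sign_def
  by (rule prod_sym_diff) (simp flip: prod.distrib, auto intro!: prod.neutral)

lemma reorder_sign_sym_diff_right:
  "reorder_sign C (sym_diff A B) = reorder_sign C A * reorder_sign C B"
proof -
  have "reorder_sign C (sym_diff A B) =
      (\<Prod>a\<in>C. (\<Prod>b\<in>A. if b < a then -1 else 1) * (\<Prod>b\<in>B. if b < a then -1 else 1))"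
    unfolding reorder_sign_def by (intro prod.cong refl prod_sym_diff) auto
  then show ?thesis
    by (simp add: reorder_sign_def prod.distrib)
qed

lemma sym_diff_cancel: "sym_diff A (sym_diff A B) = B"
  by auto

instantiation clifford :: (type) real_vector
begin

definition zero_clifford :: "'a clifford" where
  "0 = Clifford (\<lambda>A. 0)"

definition plus_clifford :: "'a clifford \<Rightarrow> 'a clifford \<Rightarrow> 'a clifford" where
  "x + y = Clifford (\<lambda>A. coeff_at x A + coeff_at y A)"

definition minus_clifford :: "'a clifford \<Rightarrow> 'a clifford \<Rightarrow> 'a clifford" where
  "x - y = Clifford (\<lambda>A. coeff_at x A - coeff_at y A)"

definition uminus_clifford :: "'a clifford \<Rightarrow> 'a clifford" where
  "- x = Clifford (\<lambda>A. - coeff_at x A)"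

definition scaleR_clifford :: "real \<Rightarrow> 'a clifford \<Rightarrow> 'a clifford" where
  "c *\<^sub>R x = Clifford (\<lambda>A. c * coeff_at x A)"

instance
  by standard
    (auto intro!: clifford_eqI simp: zero_clifford_def plus_clifford_def minus_clifford_def
      uminus_clifford_def scaleR_clifford_def algebra_simps)

end

lemma coeff_at_linear [simp]:
  "coeff_at 0 A = 0"
  "coeff_at (x + y) A = coeff_at x A + coeff_at y A"
  "coeff_at (x - y) A = coeff_at x A - coeff_at y A"
  "coeff_at (- x) A = - coeff_at x A"
  "coeff_at (c *\<^sub>R x) A = c * coeff_at x A"
  by (simp_all add: zero_clifford_def plus_clifford_def minus_clifford_def
      uminus_clifford_def scaleR_clifford_def)

lemma coeff_at_sum [simp]: "coeff_at (sum f S) A = (\<Sum>i\<in>S. coeff_at (f i) A)"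
  by (induction S rule: infinite_finite_induct) auto

text \<open>
  In the product, \<open>sym_diff A C\<close> is the unique \<open>B\<close> such that the basis elements of \<open>A\<close> and \<open>B\<close>
  multiply to plus or minus that of \<open>C\<close>.
\<close>

instantiation clifford :: ("{finite,linorder}") real_algebra_1
begin

definition one_clifford :: "'a clifford" where
  "1 = Clifford (\<lambda>A. if A = {} then 1 else 0)"

definition times_clifford :: "'a clifford \<Rightarrow> 'a clifford \<Rightarrow> 'a clifford" where
  "x * y = Clifford (\<lambda>C. \<Sum>A\<in>UNIV.
     reorder_sign A (sym_diff A C) * coeff_at x A * coeff_at y (sym_diff A C))"

instance
proof
  fix x y z :: "'a clifford" and c :: real
  show "x * y * z = x * (y * z)"
  proof (rule clifford_eqI)
    fix D :: "'a set"
    have "coeff_at (x * y * z) D = (\<Sum>E\<in>UNIV. \<Sum>A\<in>UNIV.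
        reorder_sign E (sym_diff E D) * reorder_sign A (sym_diff A E) *
        coeff_at x A * coeff_at y (sym_diff A E) * coeff_at z (sym_diff E D))"
      by (simp add: times_clifford_def sum_distrib_left sum_distrib_right ac_simps)
    also have "\<dots> = (\<Sum>A\<in>UNIV. \<Sum>E\<in>UNIV.
        reorder_sign E (sym_diff E D) * reorder_sign A (sym_diff A E) *
        coeff_at x A * coeff_at y (sym_diff A E) * coeff_at z (sym_diff E D))"
      by (rule sum.swap)
    also have "\<dots> = (\<Sum>A\<in>UNIV. \<Sum>B\<in>UNIV.
        reorder_sign A (sym_diff A D) * reorder_sign B (sym_diff B (sym_diff A D)) *
        coeff_at x A * coeff_at y B * coeff_at z (sym_diff B (sym_diff A D)))"
    proof (rule sum.cong[OF refl])
      fix A :: "'a set"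
      show "(\<Sum>E\<in>UNIV. reorder_sign E (sym_diff E D) * reorder_sign A (sym_diff A E) *
          coeff_at x A * coeff_at y (sym_diff A E) * coeff_at z (sym_diff E D)) =
        (\<Sum>B\<in>UNIV. reorder_sign A (sym_diff A D) * reorder_sign B (sym_diff B (sym_diff A D)) *
          coeff_at x A * coeff_at y B * coeff_at z (sym_diff B (sym_diff A D)))"
      proof (rule sum.reindex_bij_witness[where i = "sym_diff A" and j = "sym_diff A"])
        fix E :: "'a set"
        define B where "B = sym_diff A E"
        define C where "C = sym_diff E D"
        have eqs: "E = sym_diff A B" "sym_diff A D = sym_diff B C"
          "sym_diff B (sym_diff A D) = C"
          unfolding B_def C_def by blast+
        have "reorder_sign A (sym_diff A D) * reorder_sign B C =
            reorder_sign E C * reorder_sign A B"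
          unfolding eqs(2) eqs(1)
          by (simp only: reorder_sign_sym_diff_left reorder_sign_sym_diff_right ac_simps)
        then show "reorder_sign A (sym_diff A D) *
            reorder_sign (sym_diff A E) (sym_diff (sym_diff A E) (sym_diff A D)) *
            coeff_at x A * coeff_at y (sym_diff A E) *
            coeff_at z (sym_diff (sym_diff A E) (sym_diff A D)) =
          reorder_sign E (sym_diff E D) * reorder_sign A (sym_diff A E) *
            coeff_at x A * coeff_at y (sym_diff A E) * coeff_at z (sym_diff E D)"
          unfolding B_def[symmetric] C_def[symmetric] eqs(3) by simp
      qed (simp_all only: sym_diff_cancel UNIV_I)
    qed
    also have "\<dots> = coeff_at (x * (y * z)) D"
      by (simp add: times_clifford_def sum_distrib_left ac_simps)
    finally show "coeff_at (x * y * z) D = coeff_at (x * (y * z)) D" .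
  qed
  show "1 * x = x"
  proof (rule clifford_eqI)
    fix C
    have "coeff_at (1 * x) C = (\<Sum>A\<in>(UNIV :: 'a set set). if A = {} then coeff_at x C else 0)"
      unfolding times_clifford_def one_clifford_def coeff_at_Clifford
      by (intro sum.cong) auto
    then show "coeff_at (1 * x) C = coeff_at x C"
      by simp
  qed
  show "x * 1 = x"
  proof (rule clifford_eqI)
    fix C
    have "coeff_at (x * 1) C = (\<Sum>A\<in>UNIV. if A = C then coeff_at x C else 0)"
      unfolding times_clifford_def one_clifford_def coeff_at_Clifford
      by (intro sum.cong) auto
    then show "coeff_at (x * 1) C = coeff_at x C"
      by simp
  qed
  show "(x + y) * z = x * z + y * z" "x * (y + z) = x * y + x * z"
    by (auto intro!: clifford_eqI simp: times_clifford_def algebra_simps sum.distrib)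
  show "c *\<^sub>R x * y = c *\<^sub>R (x * y)" "x * c *\<^sub>R y = c *\<^sub>R (x * y)"
    by (auto intro!: clifford_eqI simp: times_clifford_def sum_distrib_left ac_simps)
  have "coeff_at (0 :: 'a clifford) {} \<noteq> coeff_at 1 {}"
    by (simp add: one_clifford_def)
  then show "(0 :: 'a clifford) \<noteq> 1"
    by metis
qed

end

definition gen :: "'n \<Rightarrow> 'n clifford" where
  "gen i = Clifford (\<lambda>A. if A = {i} then 1 else 0)"

definition cvec :: "real ^ 'n \<Rightarrow> 'n clifford" where
  "cvec v = (\<Sum>i\<in>UNIV. (v $ i) *\<^sub>R gen i)"

text \<open>The generators satisfy the defining relations and their increasing products are a basis.\<close>

definition blade :: "'n set \<Rightarrow> 'n clifford" where
  "blade A = Clifford (\<lambda>C. if C = A then 1 else 0)"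

lemma blade_mult: "blade A * blade B = reorder_sign A B *\<^sub>R blade (sym_diff A B)"
proof (rule clifford_eqI)
  fix C :: "'a set"
  have iff: "sym_diff A C = B \<longleftrightarrow> C = sym_diff A B"
    by blast
  have "coeff_at (blade A * blade B) C =
      (\<Sum>D\<in>UNIV. if D = A then (if C = sym_diff A B then reorder_sign A B else 0) else 0)"
    unfolding times_clifford_def blade_def coeff_at_Clifford
    by (intro sum.cong) (auto simp only: iff sym_diff_cancel split: if_splits)
  then show "coeff_at (blade A * blade B) C = coeff_at (reorder_sign A B *\<^sub>R blade (sym_diff A B)) C"
    by (simp add: blade_def)
qed

lemma gen_eq_blade: "gen i = blade {i}"
  by (simp add: gen_def blade_def)

lemma blade_empty: "blade {} = 1"
  by (simp add: blade_def one_clifford_def)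

lemma gen_square: "gen i * gen i = 1"
  by (simp add: gen_eq_blade blade_mult reorder_sign_def blade_empty)

lemma gen_anticommute:
  assumes "i \<noteq> j"
  shows "gen i * gen j = - (gen j * gen i)"
proof -
  have "sym_diff {i} {j} = {i, j}" "sym_diff {j} {i} = {i, j}"
    using assms by auto
  then show ?thesis
    using assms unfolding gen_eq_blade blade_mult by (auto simp: reorder_sign_def)
qed

lemma clifford_eq_sum_blades:
  fixes x :: "'n::finite clifford"
  shows "x = (\<Sum>A\<in>UNIV. coeff_at x A *\<^sub>R blade A)"
proof (rule clifford_eqI)
  fix C
  have "coeff_at (\<Sum>A\<in>UNIV. coeff_at x A *\<^sub>R blade A) C =
      (\<Sum>A\<in>UNIV. if A = C then coeff_at x A else 0)"
    unfolding coeff_at_sum by (intro sum.cong) (auto simp: blade_def)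
  then show "coeff_at x C = coeff_at (\<Sum>A\<in>UNIV. coeff_at x A *\<^sub>R blade A) C"
    by simp
qed

lemma prod_list_gen_increasing:
  assumes "sorted_wrt (<) xs"
  shows "prod_list (map gen xs) = blade (set xs)"
  using assms
proof (induction xs)
  case Nil
  show ?case by (simp add: blade_empty)
next
  case (Cons a xs)
  have "sym_diff {a} (set xs) = set (a # xs)"
    using Cons.prems by auto
  moreover have "reorder_sign {a} (set xs) = 1"
    using Cons.prems by (auto simp: reorder_sign_def intro!: prod.neutral)
  ultimately have "blade {a} * blade (set xs) = blade (set (a # xs))"
    unfolding blade_mult by (simp only: scaleR_one)
  moreover have "prod_list (map gen xs) = blade (set xs)"
    using Cons by simp
  ultimately show ?case
    by (simp only: list.map prod_list.Cons gen_eq_blade[of a])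
qed

lemma blade_eq_prod_list: "blade A = prod_list (map gen (sorted_list_of_set A))"
  by (simp add: prod_list_gen_increasing)

definition reversal :: "'n::{finite,linorder} clifford \<Rightarrow> 'n clifford" where
  "reversal x =
     (\<Sum>A\<in>UNIV. coeff_at x A *\<^sub>R prod_list (map gen (rev (sorted_list_of_set A))))"

lemma prod_list_gen_decreasing:
  assumes "sorted_wrt (<) xs"
  shows "prod_list (map gen (rev xs)) = reorder_sign (set xs) (set xs) *\<^sub>R blade (set xs)"
  using assms
proof (induction xs)
  case Nil
  show ?case by (simp add: blade_empty)
next
  case (Cons a xs)
  have sd: "sym_diff (set xs) {a} = set (a # xs)"
    using Cons.prems by auto
  have 1: "reorder_sign {a} (set xs) = 1"
    using Cons.prems by (auto simp: reorder_sign_def intro!: prod.neutral)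
  have 2: "reorder_sign {a} {a} = 1"
    by (simp add: reorder_sign_def)
  have "reorder_sign (set (a # xs)) (set (a # xs)) =
      reorder_sign (set xs) (set xs) * reorder_sign (set xs) {a}"
    unfolding sd[symmetric] reorder_sign_sym_diff_left reorder_sign_sym_diff_right 1 2 by simp
  moreover have "prod_list (map gen (rev xs)) = reorder_sign (set xs) (set xs) *\<^sub>R blade (set xs)"
    using Cons by simp
  moreover have "prod_list (map gen (rev (a # xs))) = prod_list (map gen (rev xs)) * blade {a}"
    by (simp add: gen_eq_blade[of a])
  ultimately show ?case
    by (simp only: mult_scaleR_left scaleR_scaleR blade_mult sd)
qed

lemma reversal_eq:
  "reversal x = (\<Sum>A\<in>UNIV. coeff_at x A *\<^sub>R (reorder_sign A A *\<^sub>R blade A))"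
  by (simp add: reversal_def prod_list_gen_decreasing)

lemma coeff_at_reversal: "coeff_at (reversal x) A = reorder_sign A A * coeff_at x A"
proof -
  have "coeff_at (reversal x) A = (\<Sum>B\<in>UNIV. if B = A then reorder_sign A A * coeff_at x A else 0)"
    unfolding reversal_eq coeff_at_sum by (intro sum.cong) (auto simp: blade_def)
  then show ?thesis
    by simp
qed

lemma reversal_mult: "reversal (x * y) = reversal y * reversal x"
proof (rule clifford_eqI)
  fix C :: "'a set"
  have "coeff_at (reversal (x * y)) C = (\<Sum>A\<in>UNIV. reorder_sign C C *
      reorder_sign A (sym_diff A C) * coeff_at x A * coeff_at y (sym_diff A C))"
    by (simp add: coeff_at_reversal times_clifford_def sum_distrib_left ac_simps)
  also have "\<dots> = (\<Sum>B\<in>UNIV. reorder_sign B (sym_diff B C) *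
      (reorder_sign B B * coeff_at y B) *
      (reorder_sign (sym_diff B C) (sym_diff B C) * coeff_at x (sym_diff B C)))"
  proof (rule sum.reindex_bij_witness[where i = "\<lambda>B. sym_diff B C" and j = "\<lambda>A. sym_diff A C"])
    fix A :: "'a set"
    define B where "B = sym_diff A C"
    have A: "sym_diff B C = A" and C: "C = sym_diff A B"
      unfolding B_def by blast+
    have "reorder_sign A B * reorder_sign A B = 1"
      unfolding reorder_sign_def
      by (simp flip: prod.distrib) (auto intro!: prod.neutral)
    moreover have "reorder_sign C C = reorder_sign A A * reorder_sign A B *
        (reorder_sign B A * reorder_sign B B)"
      unfolding C reorder_sign_sym_diff_left reorder_sign_sym_diff_right by (simp only: ac_simps)
    ultimately have "reorder_sign C C * reorder_sign A B =
        reorder_sign B A * reorder_sign B B * reorder_sign A A"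
      by (simp add: algebra_simps)
    then show "reorder_sign (sym_diff A C) (sym_diff (sym_diff A C) C) *
        (reorder_sign (sym_diff A C) (sym_diff A C) * coeff_at y (sym_diff A C)) *
        (reorder_sign (sym_diff (sym_diff A C) C) (sym_diff (sym_diff A C) C) *
          coeff_at x (sym_diff (sym_diff A C) C)) =
      reorder_sign C C * reorder_sign A (sym_diff A C) * coeff_at x A * coeff_at y (sym_diff A C)"
      unfolding B_def[symmetric] A by (simp add: ac_simps)
  qed auto
  also have "\<dots> = coeff_at (reversal y * reversal x) C"
    by (simp add: times_clifford_def coeff_at_reversal)
  finally show "coeff_at (reversal (x * y)) C = coeff_at (reversal y * reversal x) C" .
qed

lemma reversal_cvec: "reversal (cvec v) = cvec v"
proof (rule clifford_eqI)
  fix A :: "'a set"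
  show "coeff_at (reversal (cvec v)) A = coeff_at (cvec v) A"
  proof (cases "\<exists>i. A = {i}")
    case True
    then show ?thesis by (auto simp: coeff_at_reversal reorder_sign_def)
  next
    case False
    then have "coeff_at (cvec v) A = 0"
      by (auto simp: cvec_def gen_def)
    then show ?thesis by (simp add: coeff_at_reversal)
  qed
qed

lemma reversal_one: "reversal 1 = 1"
  by (rule clifford_eqI) (simp add: coeff_at_reversal one_clifford_def)

lemma reversal_prod_list:
  "reversal (prod_list (map cvec vs)) = prod_list (map cvec (rev vs))"
  by (induction vs) (simp_all add: reversal_one reversal_mult reversal_cvec)

text \<open>The exponential series, which converges coefficientwise.\<close>

definition cl_exp :: "'n::{finite,linorder} clifford \<Rightarrow> 'n clifford" where
  "cl_exp x = Clifford (\<lambda>A. \<Sum>n. coeff_at (x ^ n) A / fact n)"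

lemma cl_exp_bivector:
  fixes B :: "'n::{finite,linorder} clifford"
  assumes "B * B = -1"
  shows "cl_exp (\<theta> *\<^sub>R B) = cos \<theta> *\<^sub>R 1 + sin \<theta> *\<^sub>R B"
proof (rule clifford_eqI)
  fix A :: "'n set"
  have scale: "(\<theta> *\<^sub>R B) ^ n = \<theta> ^ n *\<^sub>R B ^ n" for n
    by (induction n) (simp_all add: ac_simps)
  have even: "B ^ (2 * k) = (-1) ^ k *\<^sub>R 1" for k
    by (induction k) (simp_all add: assms flip: mult.assoc)
  have odd: "B ^ Suc (2 * k) = (-1) ^ k *\<^sub>R B" for k
    by (simp add: even del: power_Suc add: power_Suc2)
  have pow: "coeff_at ((\<theta> *\<^sub>R B) ^ n) A / fact n =
      cos_coeff n * \<theta> ^ n * coeff_at 1 A + sin_coeff n * \<theta> ^ n * coeff_at B A" for n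
  proof (cases "even n")
    case True
    then obtain k where n: "n = 2 * k" by (elim evenE)
    have "(\<theta> *\<^sub>R B) ^ n = \<theta> ^ n *\<^sub>R ((-1) ^ k *\<^sub>R 1)"
      unfolding scale unfolding n even ..
    then show ?thesis
      by (simp add: n cos_coeff_def sin_coeff_def)
  next
    case False
    then obtain k where n: "n = Suc (2 * k)" by (metis oddE Suc_eq_plus1)
    have "(\<theta> *\<^sub>R B) ^ n = \<theta> ^ n *\<^sub>R ((-1) ^ k *\<^sub>R B)"
      unfolding scale unfolding n odd ..
    then show ?thesis
      by (simp add: n cos_coeff_def sin_coeff_def)
  qed
  have "(\<lambda>n. cos_coeff n * \<theta> ^ n * coeff_at 1 A + sin_coeff n * \<theta> ^ n * coeff_at B A) sums
      (cos \<theta> * coeff_at 1 A + sin \<theta> * coeff_at B A)"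
    using cos_converges[of \<theta>] sin_converges[of \<theta>]
    by (intro sums_add sums_mult2) simp_all
  then show "coeff_at (cl_exp (\<theta> *\<^sub>R B)) A = coeff_at (cos \<theta> *\<^sub>R 1 + sin \<theta> *\<^sub>R B) A"
    by (simp add: cl_exp_def pow sums_iff)
qed

text \<open>
  For \<open>W = a1 ... ak\<close> a product of unit vectors, \<open>reversal W * cvec v * W = ak ... a1 v a1 ... ak\<close>
  is again a vector, and for even \<open>k\<close> it is the image of \<open>v\<close> under the reflections
  \<open>v \<mapsto> - a v a\<close> in \<open>a1\<close>, then \<open>a2\<close>, and so on.
\<close>

definition sandwich ::
  "'n::{finite,linorder} clifford \<Rightarrow> real ^ 'n::{finite,linorder} \<Rightarrow> real ^ 'n::{finite,linorder}" where
  "sandwich W v = (THE u. cvec u = reversal W * cvec v * W)"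

definition is_unit_bivector :: "(real ^ 'n::{finite,linorder}) set \<Rightarrow> 'n clifford \<Rightarrow> bool" where
  "is_unit_bivector P B \<longleftrightarrow>
     (\<exists>u v. norm u = 1 \<and> norm v = 1 \<and> orthogonal u v \<and> span {u, v} = P \<and>
        B = cvec u * cvec v)"

definition orthogonal_subspaces :: "'a::real_inner set \<Rightarrow> 'a set \<Rightarrow> bool" where
  "orthogonal_subspaces P Q \<longleftrightarrow> (\<forall>x\<in>P. \<forall>y\<in>Q. orthogonal x y)"


section \<open>Root systems and Coxeter versors\<close>

definition D_roots :: "(real ^ 'n) set" where
  "D_roots = {s *\<^sub>R axis i 1 + t *\<^sub>R axis j 1 | s t i j. i \<noteq> j \<and> s \<in> {1, -1} \<and> t \<in> {1, -1}}"

definition simple_system :: "'a::real_vector set \<Rightarrow> 'a set \<Rightarrow> bool" where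
  "simple_system \<Phi> \<Delta> \<longleftrightarrow> \<Delta> \<subseteq> \<Phi> \<and> independent \<Delta> \<and>
     (\<forall>\<beta>\<in>\<Phi>. \<exists>c. \<beta> = (\<Sum>\<alpha>\<in>\<Delta>. c \<alpha> *\<^sub>R \<alpha>) \<and>
        ((\<forall>\<alpha>\<in>\<Delta>. c \<alpha> \<ge> 0) \<or> (\<forall>\<alpha>\<in>\<Delta>. c \<alpha> \<le> 0)))"

definition versor :: "(real ^ 'n::{finite,linorder}) list \<Rightarrow> 'n clifford" where
  "versor \<alpha>s = prod_list (map (\<lambda>\<alpha>. cvec ((1 / norm \<alpha>) *\<^sub>R \<alpha>)) \<alpha>s)"


section \<open>Coxeter number, exponents and Coxeter plane of a Coxeter element\<close>

definition coxeter_number :: "(real ^ 'n \<Rightarrow> real ^ 'n) \<Rightarrow> nat" where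
  "coxeter_number w = (LEAST n. 0 < n \<and> w ^^ n = id)"

definition complex_charpoly :: "(real ^ 'n \<Rightarrow> real ^ 'n) \<Rightarrow> complex poly" where
  "complex_charpoly w =
     det ((\<chi> i j. (if i = j then [:0, 1:] else 0) - [:complex_of_real (matrix w $ i $ j):])
       :: complex poly ^ 'n ^ 'n)"

text \<open>The multiplicity of an exponent is the algebraic multiplicity of its eigenvalue.\<close>

definition exponents :: "(real ^ 'n \<Rightarrow> real ^ 'n) \<Rightarrow> nat multiset" where
  "exponents w = (\<Sum>m\<in>{0<..<coxeter_number w}.
     replicate_mset
       (order (exp (2 * of_real pi * \<i> * of_nat m / of_nat (coxeter_number w)))
         (complex_charpoly w)) m)"

definition acts_as_rotation :: "('a::real_inner \<Rightarrow> 'a) \<Rightarrow> 'a set \<Rightarrow> real \<Rightarrow> bool" where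
  "acts_as_rotation w P \<theta> \<longleftrightarrow>
     (\<exists>u v. norm u = 1 \<and> norm v = 1 \<and> orthogonal u v \<and> span {u, v} = P \<and>
        w u = cos \<theta> *\<^sub>R u + sin \<theta> *\<^sub>R v \<and> w v = - sin \<theta> *\<^sub>R u + cos \<theta> *\<^sub>R v)"

definition is_coxeter_plane :: "(real ^ 'n \<Rightarrow> real ^ 'n) \<Rightarrow> (real ^ 'n) set \<Rightarrow> bool" where
  "is_coxeter_plane w P \<longleftrightarrow> acts_as_rotation w P (2 * pi / real (coxeter_number w))"

end

theory Submission
  imports Defs
begin

text \<open>
  A simple system of \<open>D\<^sub>6\<close> is, in a suitable orthonormal frame \<open>f 0, ..., f 5\<close>, the standard one:
  \<open>f 0 - f 1, ..., f 4 - f 5\<close> and \<open>f 4 + f 5\<close> (\<open>D_simple_system\<close>). Its diagram is a tree, so the products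
  of the simple roots in different orders arise from each other by moving factors from the front
  to the back and by exchanging orthogonal factors. The former is conjugation by a
  versor and the latter changes at most the sign, and the asserted shape of the versor survives
  both: the three planes move along with the conjugation, and a sign is absorbed by the
  orientation of the third plane (\<open>all_orders_merge\<close>, \<open>is_D6_versor_conj\<close>, \<open>is_D6_versor_minus\<close>).
  So a single order of the factors has to be considered.

  For a convenient order the Coxeter element is \<open>f 0 \<mapsto> f 1 \<mapsto> ... \<mapsto> f 4 \<mapsto> - f 0\<close>,
  \<open>f 5 \<mapsto> - f 5\<close> (\<open>standard_coxeter_versor\<close>). A discrete Fourier transform of \<open>f 0, ..., f 4\<close> at the
  frequencies \<open>1\<close>, \<open>3\<close> and \<open>5\<close> splits the space into three orthogonal planes that it rotates by
  \<open>pi / 5\<close>, \<open>3 * pi / 5\<close> and \<open>pi\<close>. A rotor has half the angle of its rotation, so the product of rotors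
  in the statement acts in the same way, and a versor is determined by its action up to sign,
  as the centre of the Clifford algebra of an even-dimensional space consists of scalars
  (\<open>signed_cycle_imp_D6_versor\<close>, \<open>versor_determined_by_action\<close>).

  The three angles determine everything else. The order of the Coxeter element is \<open>10\<close>,
  the first plane is rotated by \<open>2 * pi / 10\<close>, and the complex eigenvectors in the three
  planes give the exponents \<open>1, 9\<close>, \<open>3, 7\<close> and \<open>5, 5\<close> (\<open>D6_rotation\<close>).
\<close>

section \<open>Vectors in the Clifford algebra\<close>

lemma linear_cvec: "linear cvec"
  by (rule linearI) (simp_all add: cvec_def scaleR_add_left sum.distrib scaleR_sum_right)

lemmas cvec_linear = linear_add[OF linear_cvec] linear_diff[OF linear_cvec]
  linear_scale[OF linear_cvec] linear_neg[OF linear_cvec] linear_0[OF linear_cvec]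

lemma cvec_axis: "cvec (axis i 1) = gen i"
proof -
  have "cvec (axis i 1) = (\<Sum>j\<in>UNIV. if j = i then gen i else 0)"
    unfolding cvec_def by (intro sum.cong) (auto simp: axis_def)
  then show ?thesis by simp
qed

lemma coeff_at_cvec: "coeff_at (cvec v) {i} = v $ i"
  by (simp add: cvec_def gen_def if_distrib cong: if_cong)

lemma cvec_inject: "cvec u = cvec v \<longleftrightarrow> u = v"
  by (metis coeff_at_cvec vec_eq_iff)

text \<open>
  The polarised form of \<open>v v = v \<bullet> v\<close>. It makes computations with orthonormal vectors
  independent of the coordinates in which the algebra is built.
\<close>

lemma cvec_anticommutator:
  fixes u v :: "real ^ 'n::{finite,linorder}"
  shows "cvec u * cvec v + cvec v * cvec u = (2 * (u \<bullet> v)) *\<^sub>R 1"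
proof -
  have gens: "gen i * gen j + gen j * gen i = (if i = j then 2 else 0) *\<^sub>R (1 :: 'n clifford)" for i j
    using gen_anticommute[of i j] by (auto simp: gen_square scaleR_2)
  have uv: "cvec u * cvec v = (\<Sum>i\<in>UNIV. \<Sum>j\<in>UNIV. (u $ i * v $ j) *\<^sub>R (gen i * gen j))"
    unfolding cvec_def by (simp add: sum_product mult.commute)
  have vu: "cvec v * cvec u = (\<Sum>i\<in>UNIV. \<Sum>j\<in>UNIV. (u $ i * v $ j) *\<^sub>R (gen j * gen i))"
    unfolding cvec_def by (subst sum.swap) (simp add: sum_product mult.commute)
  have "cvec u * cvec v + cvec v * cvec u =
      (\<Sum>i\<in>UNIV. \<Sum>j\<in>UNIV. (u $ i * v $ j) *\<^sub>R (gen i * gen j + gen j * gen i))"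
    unfolding uv vu by (simp add: sum.distrib scaleR_add_right)
  also have "\<dots> = (\<Sum>i\<in>UNIV. \<Sum>j\<in>UNIV. if i = j then (2 * (u $ i * v $ i)) *\<^sub>R 1 else 0)"
    unfolding gens by (intro sum.cong refl) simp
  also have "\<dots> = (\<Sum>i\<in>UNIV. (2 * (u $ i * v $ i)) *\<^sub>R 1)"
    by simp
  also have "\<dots> = (2 * (u \<bullet> v)) *\<^sub>R 1"
    by (simp add: inner_vec_def sum_distrib_left scaleR_left.sum)
  finally show ?thesis .
qed

lemma cvec_square: "cvec u * cvec u = (u \<bullet> u) *\<^sub>R 1"
proof -
  have "2 *\<^sub>R (cvec u * cvec u) = 2 *\<^sub>R ((u \<bullet> u) *\<^sub>R 1)"
    using cvec_anticommutator[of u u] by (simp add: scaleR_2)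
  then show ?thesis
    by (simp only: real_vector.scale_left_imp_eq[OF zero_neq_numeral[symmetric]])
qed

lemma cvec_unit: "norm u = 1 \<Longrightarrow> cvec u * cvec u = 1"
  by (simp add: cvec_square norm_eq_1)

lemma cvec_orthogonal: "orthogonal u v \<Longrightarrow> cvec v * cvec u = - (cvec u * cvec v)"
  using cvec_anticommutator[of u v] by (simp add: orthogonal_def eq_neg_iff_add_eq_0 add.commute)

text \<open>The map \<open>v \<mapsto> a v a\<close> is the negative of the reflection in the hyperplane orthogonal to \<open>a\<close>.\<close>

lemma cvec_conj:
  fixes a v :: "real ^ 'n::{finite,linorder}"
  assumes "norm a = 1"
  shows "cvec a * cvec v * cvec a = cvec ((2 * (a \<bullet> v)) *\<^sub>R a - v)"
proof -
  have "cvec v * cvec a = (2 * (a \<bullet> v)) *\<^sub>R 1 - cvec a * cvec v"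
    using cvec_anticommutator[of a v] by (simp add: eq_diff_eq add.commute)
  then have "cvec a * (cvec v * cvec a) = (2 * (a \<bullet> v)) *\<^sub>R cvec a - cvec a * cvec a * cvec v"
    by (simp add: right_diff_distrib mult.assoc)
  then show ?thesis
    using cvec_unit[OF assms] by (simp add: mult.assoc cvec_linear)
qed

lemma reversal_linear:
  "reversal (x + y) = reversal x + reversal y"
  "reversal (x - y) = reversal x - reversal y"
  "reversal (c *\<^sub>R x) = c *\<^sub>R reversal x"
  by (rule clifford_eqI, simp add: coeff_at_reversal algebra_simps)+

lemma sandwich_eqI:
  assumes "reversal W * cvec v * W = cvec u"
  shows "sandwich W v = u"
  unfolding sandwich_def using assms by (auto simp: cvec_inject)

text \<open>
  Moving \<open>gen i\<close> past a basis element costs one sign for each generator different from \<open>gen i\<close>.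
\<close>

lemma reorder_sign_singleton_swap:
  "reorder_sign {i} A * reorder_sign A {i} = (-1) ^ card (A - {i})"
proof -
  have "reorder_sign {i} A * reorder_sign A {i} = (\<Prod>b\<in>A. if b = i then 1 else -1)"
    unfolding reorder_sign_def
    by (simp flip: prod.distrib, intro prod.cong) auto
  also have "\<dots> = (\<Prod>b\<in>A - {i}. -1)"
    by (rule prod.mono_neutral_cong_right) auto
  finally show ?thesis by simp
qed

lemma coeff_at_gen_mult:
  "coeff_at (gen i * x) (sym_diff {i} A) = reorder_sign {i} A * coeff_at x A"
  "coeff_at (x * gen i) (sym_diff {i} A) = reorder_sign A {i} * coeff_at x A"
proof -
  have "coeff_at (gen i * x) (sym_diff {i} A) =
      (\<Sum>B\<in>UNIV. if B = {i} then reorder_sign {i} A * coeff_at x A else 0)"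
    unfolding times_clifford_def gen_def coeff_at_Clifford
    by (intro sum.cong refl) (auto simp only: sym_diff_cancel split: if_splits)
  then show "coeff_at (gen i * x) (sym_diff {i} A) = reorder_sign {i} A * coeff_at x A"
    by simp
  have iff: "sym_diff B (sym_diff {i} A) = {i} \<longleftrightarrow> B = A" for B
    by blast
  have "coeff_at (x * gen i) (sym_diff {i} A) =
      (\<Sum>B\<in>UNIV. if B = A then reorder_sign A {i} * coeff_at x A else 0)"
    unfolding times_clifford_def gen_def coeff_at_Clifford iff
  proof (intro sum.cong refl)
    fix B
    have "sym_diff A (sym_diff {i} A) = {i}" by blast
    then show "reorder_sign B (sym_diff B (sym_diff {i} A)) * coeff_at x B * (if B = A then 1 else 0)
        = (if B = A then reorder_sign A {i} * coeff_at x A else 0)"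
      by simp
  qed
  then show "coeff_at (x * gen i) (sym_diff {i} A) = reorder_sign A {i} * coeff_at x A"
    by simp
qed

text \<open>
  In even dimension the centre consists of the scalars. A nonempty set \<open>A\<close> of generators always
  leaves an odd number of elements after removal of a suitable \<open>i\<close>: take \<open>i\<close> inside \<open>A\<close> if \<open>A\<close>
  has even size, and outside otherwise, which is possible because \<open>A\<close> is then not everything.
  For this \<open>i\<close>, \<open>gen i\<close> anticommutes with the basis element of \<open>A\<close>.
\<close>

lemma central_imp_scalar:
  fixes x :: "'n::{finite,linorder} clifford"
  assumes comm: "\<And>i. gen i * x = x * gen i" and even: "even CARD('n)"
  shows "x = coeff_at x {} *\<^sub>R 1"
proof -
  have "coeff_at x A = 0" if ne: "A \<noteq> {}" for A
  proof -
    have "\<exists>i. odd (card (A - {i}))"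
    proof (cases "even (card A)")
      case True
      obtain i where "i \<in> A" using ne by blast
      moreover from this have "card A \<noteq> 0" by auto
      ultimately have "odd (card (A - {i}))" using True by simp
      then show ?thesis ..
    next
      case False
      then have "A \<noteq> UNIV" using even by auto
      then obtain i where "i \<notin> A" by blast
      then show ?thesis using False by (metis Diff_empty Diff_insert0)
    qed
    then obtain i where i: "odd (card (A - {i}))" ..
    have sq: "reorder_sign A {i} * reorder_sign A {i} = 1"
      unfolding reorder_sign_def by (simp flip: prod.distrib) (auto intro!: prod.neutral)
    have "reorder_sign {i} A * coeff_at x A = reorder_sign A {i} * coeff_at x A"
      using coeff_at_gen_mult[where i = i and x = x and A = A] unfolding comm[of i]
      by (simp only:)
    then have "reorder_sign A {i} * reorder_sign {i} A * coeff_at x A =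
        reorder_sign A {i} * reorder_sign A {i} * coeff_at x A"
      by (simp only: mult.assoc)
    then have "reorder_sign {i} A * reorder_sign A {i} * coeff_at x A = coeff_at x A"
      unfolding sq by (simp only: mult.commute mult_1)
    with i show ?thesis
      by (simp add: reorder_sign_singleton_swap)
  qed
  then show ?thesis
    by (intro clifford_eqI) (auto simp: one_clifford_def)
qed

section \<open>Versors and their action on vectors\<close>

text \<open>
  Only invertibility by reversal is asked for. This contains all products of unit vectors and
  all rotors, and it suffices for cancelling \<open>W\<close> in \<open>reversal W * v * W\<close>.
\<close>

definition unit_versors :: "'n::{finite,linorder} clifford set" where
  "unit_versors = {W. reversal W * W = 1 \<and> W * reversal W = 1}"

lemma unit_versors_mult: "V \<in> unit_versors \<Longrightarrow> W \<in> unit_versors \<Longrightarrow> V * W \<in> unit_versors"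
proof -
  assume "V \<in> unit_versors" "W \<in> unit_versors"
  then have V: "reversal V * V = 1" "V * reversal V = 1"
    and W: "reversal W * W = 1" "W * reversal W = 1"
    by (auto simp: unit_versors_def)
  have "reversal W * reversal V * (V * W) = reversal W * (reversal V * V) * W"
    "V * W * (reversal W * reversal V) = V * (W * reversal W) * reversal V"
    by (simp_all only: mult.assoc)
  then show ?thesis
    unfolding unit_versors_def reversal_mult mem_Collect_eq V W by (simp add: V W)
qed

lemma unit_versors_cvec: "norm a = 1 \<Longrightarrow> cvec a \<in> unit_versors"
  by (simp add: unit_versors_def reversal_cvec cvec_unit)

text \<open>
  If \<open>V\<close> and \<open>W\<close> act alike, \<open>V * reversal W\<close> commutes with all vectors, so it is a scalar, and its
  square is \<open>1\<close>. Thus an identity between versors can be checked on vectors, up to sign.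
\<close>

lemma versor_determined_by_action:
  fixes V W :: "'n::{finite,linorder} clifford"
  assumes V: "V \<in> unit_versors" and W: "W \<in> unit_versors" and even: "even CARD('n)"
    and eq: "\<And>v. reversal V * cvec v * V = reversal W * cvec v * W"
  shows "V = W \<or> V = - W"
proof -
  define x where "x = V * reversal W"
  have V1: "V * reversal V = 1" and W1: "reversal W * W = 1" "W * reversal W = 1"
    using V W by (auto simp: unit_versors_def)
  have "gen i * x = x * gen i" for i
  proof -
    have "V * (reversal V * cvec (axis i 1) * V) * reversal W =
        V * (reversal W * cvec (axis i 1) * W) * reversal W"
      using eq by simp
    then have "(V * reversal V) * gen i * x = x * gen i * (W * reversal W)"
      by (simp add: x_def cvec_axis mult.assoc)
    then show ?thesis
      using V1 W1 by simp
  qed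
  then obtain c where c: "x = c *\<^sub>R 1"
    using central_imp_scalar even by metis
  have "x * W = V"
    using W1 by (simp add: x_def mult.assoc)
  then have VW: "V = c *\<^sub>R W"
    by (simp add: c)
  have "(c * c) *\<^sub>R (1 :: 'n clifford) = 1"
    using V1 W1 by (simp add: VW reversal_linear)
  then have "coeff_at ((c * c) *\<^sub>R (1 :: 'n clifford)) {} = coeff_at (1 :: 'n clifford) {}"
    by simp
  then have "c * c = 1"
    by (simp add: one_clifford_def)
  then have "c = 1 \<or> c = -1"
    by (simp add: square_eq_1_iff)
  then show ?thesis
    using VW by auto
qed

section \<open>Rotors\<close>

lemma bivector_square:
  assumes "norm u = 1" "norm v = 1" "orthogonal u v"
  shows "(cvec u * cvec v) * (cvec u * cvec v) = -1"
proof -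
  have "(cvec u * cvec v) * (cvec u * cvec v) = cvec u * (cvec v * cvec u) * cvec v"
    by (simp add: mult.assoc)
  also have "\<dots> = - ((cvec u * cvec u) * (cvec v * cvec v))"
    unfolding cvec_orthogonal[OF assms(3)] by (simp add: mult.assoc)
  finally show ?thesis
    using assms by (simp add: cvec_unit)
qed

text \<open>
  The rotor \<open>R\<close> of the plane of \<open>u\<close>, \<open>v\<close> behaves like the complex number with angle \<open>\<theta>\<close>.
  A vector in the plane anticommutes with \<open>B\<close>, so both factors of \<open>reversal R * x * R\<close> end up on
  the same side and the angle doubles; a vector orthogonal to the plane commutes with \<open>B\<close>
  and is left fixed.
\<close>

locale rotor =
  fixes u v :: "real ^ 'n::{finite,linorder}" and \<theta> :: real
  assumes u: "norm u = 1" and v: "norm v = 1" and uv: "orthogonal u v"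
begin

abbreviation "B \<equiv> cvec u * cvec v"
abbreviation "R \<equiv> cl_exp (\<theta> *\<^sub>R B)"

lemma pair_mult: "(a *\<^sub>R 1 + b *\<^sub>R B) * (c *\<^sub>R 1 + d *\<^sub>R B) =
    (a * c - b * d) *\<^sub>R 1 + (a * d + b * c) *\<^sub>R B"
proof -
  have "(a *\<^sub>R 1 + b *\<^sub>R B) * (c *\<^sub>R 1 + d *\<^sub>R B) =
      (a * c) *\<^sub>R 1 + (a * d) *\<^sub>R B + (b * c) *\<^sub>R B + (b * d) *\<^sub>R (B * B)"
    by (simp add: distrib_left distrib_right scaleR_add_right mult.commute)
  then show ?thesis
    by (simp only: bivector_square[OF u v uv]) (simp add: algebra_simps)
qed

lemma R_eq: "R = cos \<theta> *\<^sub>R 1 + sin \<theta> *\<^sub>R B"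
  using bivector_square[OF u v uv] by (rule cl_exp_bivector)

lemma reversal_R: "reversal R = cos \<theta> *\<^sub>R 1 - sin \<theta> *\<^sub>R B"
  unfolding R_eq
  by (simp add: reversal_linear reversal_one reversal_mult reversal_cvec cvec_orthogonal[OF uv])

lemma R_unit: "R \<in> unit_versors"
proof -
  have "reversal R = cos \<theta> *\<^sub>R 1 + (- sin \<theta>) *\<^sub>R B"
    by (simp add: reversal_R)
  then show ?thesis
    unfolding unit_versors_def mem_Collect_eq by (simp only: R_eq pair_mult) (simp add: sin_cos_squared_add3)
qed

lemma R_square: "R * R = cos (2 * \<theta>) *\<^sub>R 1 + sin (2 * \<theta>) *\<^sub>R B"
  unfolding R_eq pair_mult by (simp add: cos_double sin_double power2_eq_square)

lemma conj_u: "reversal R * cvec u * R = cvec (cos (2 * \<theta>) *\<^sub>R u + sin (2 * \<theta>) *\<^sub>R v)"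
proof -
  have "B * cvec u = - (cvec u * B)"
    by (simp add: mult.assoc cvec_orthogonal[OF uv])
  then have "reversal R * cvec u = cvec u * R"
    unfolding reversal_R unfolding R_eq by (simp add: algebra_simps)
  then have "reversal R * cvec u * R = cvec u * (R * R)"
    by (simp add: mult.assoc)
  then show ?thesis
    unfolding R_square by (simp add: distrib_left cvec_linear cvec_unit[OF u] flip: mult.assoc)
qed

lemma conj_v: "reversal R * cvec v * R = cvec (- sin (2 * \<theta>) *\<^sub>R u + cos (2 * \<theta>) *\<^sub>R v)"
proof -
  have vB: "cvec v * B = - cvec u"
    unfolding mult.assoc[symmetric] cvec_orthogonal[OF uv]
    by (simp add: mult.assoc cvec_unit[OF v])
  have "B * cvec v = - (cvec v * B)"
    unfolding vB by (simp add: mult.assoc cvec_unit[OF v])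
  then have "reversal R * cvec v = cvec v * R"
    unfolding reversal_R unfolding R_eq by (simp add: algebra_simps)
  then have "reversal R * cvec v * R = cvec v * (R * R)"
    by (simp add: mult.assoc)
  then show ?thesis
    unfolding R_square by (simp add: distrib_left cvec_linear vB)
qed

lemma conj_orthogonal:
  assumes "orthogonal u x" "orthogonal v x"
  shows "reversal R * cvec x * R = cvec x"
proof -
  have "B * cvec x = cvec x * B"
  proof -
    have "cvec x * B = - (cvec u * cvec x) * cvec v"
      by (simp add: cvec_orthogonal[OF assms(1)] flip: mult.assoc)
    also have "\<dots> = - (cvec u * (cvec x * cvec v))"
      by (simp add: mult.assoc)
    also have "\<dots> = B * cvec x"
      by (simp add: cvec_orthogonal[OF assms(2)] mult.assoc)
    finally show ?thesis ..
  qed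
  then have "cvec x * R = R * cvec x"
    unfolding R_eq by (simp add: algebra_simps)
  then show ?thesis
    using R_unit by (simp add: unit_versors_def mult.assoc) (simp flip: mult.assoc)
qed

end

section \<open>Orthonormal frames\<close>

definition orthonormal_frame :: "nat \<Rightarrow> (nat \<Rightarrow> 'a::real_inner) \<Rightarrow> bool" where
  "orthonormal_frame n u \<longleftrightarrow> (\<forall>i<n. \<forall>j<n. u i \<bullet> u j = (if i = j then 1 else 0))"

lemma orthonormal_frameD:
  assumes "orthonormal_frame n u" "i < n"
  shows "norm (u i) = 1" "j < n \<Longrightarrow> i \<noteq> j \<Longrightarrow> orthogonal (u i) (u j)"
  using assms by (auto simp: orthonormal_frame_def norm_eq_1 orthogonal_def)

lemma orthonormal_frame_inner:
  "orthonormal_frame n u \<Longrightarrow> i < n \<Longrightarrow> j < n \<Longrightarrow> u i \<bullet> u j = (if i = j then 1 else 0)"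
  by (simp add: orthonormal_frame_def)

lemma orthonormal_frame_span:
  fixes u :: "nat \<Rightarrow> 'a::euclidean_space"
  assumes "orthonormal_frame DIM('a) u"
  shows "span (u ` {..<DIM('a)}) = UNIV"
proof -
  have inj: "inj_on u {..<DIM('a)}"
  proof (rule inj_onI)
    fix i j assume "i \<in> {..<DIM('a)}" "j \<in> {..<DIM('a)}" "u i = u j"
    then show "i = j"
      using orthonormal_frame_inner[OF assms, of i i] orthonormal_frame_inner[OF assms, of i j]
      by (auto split: if_splits)
  qed
  have "independent (u ` {..<DIM('a)})"
  proof (rule pairwise_orthogonal_independent)
    show "pairwise orthogonal (u ` {..<DIM('a)})"
      using orthonormal_frameD(2)[OF assms] by (auto simp: pairwise_def)
    show "0 \<notin> u ` {..<DIM('a)}"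
      using orthonormal_frameD(1)[OF assms] by force
  qed
  then have "UNIV \<subseteq> span (u ` {..<DIM('a)})"
    by (intro card_ge_dim_independent) (simp_all add: card_image[OF inj])
  then show ?thesis by blast
qed

lemma reversal_conj_mult:
  "reversal (V * W) * x * (V * W) = reversal W * (reversal V * x * V) * W"
  by (simp add: reversal_mult mult.assoc)

lemma linear_conj_cvec: "linear (\<lambda>v. reversal W * cvec v * W)"
  by (rule linearI) (simp_all add: cvec_linear distrib_left distrib_right)

text \<open>
  The description operator in \<open>sandwich\<close> is meaningful as soon as a spanning set is mapped
  to vectors, since the vectors form a subspace.
\<close>

lemma sandwich_on_spanning_set:
  fixes W :: "'n::{finite,linorder} clifford"
  assumes span: "span S = UNIV"
    and ex: "\<And>v. v \<in> S \<Longrightarrow> \<exists>x. reversal W * cvec v * W = cvec x"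
  shows "cvec (sandwich W v) = reversal W * cvec v * W" and "linear (sandwich W)"
proof -
  have "\<exists>x. reversal W * cvec v * W = cvec x" for v
  proof -
    have "v \<in> span S" using span by simp
    then show ?thesis
    proof (induction rule: span_induct_alt)
      case base
      then show ?case by (metis cvec_linear(5) mult_zero_left mult_zero_right)
    next
      case (step c x y)
      then obtain x' y' where "reversal W * cvec x * W = cvec x'" "reversal W * cvec y * W = cvec y'"
        using ex by blast
      then have "reversal W * cvec (c *\<^sub>R x + y) * W = cvec (c *\<^sub>R x' + y')"
        by (simp add: cvec_linear distrib_left distrib_right)
      then show ?case ..
    qed
  qed
  then have *: "cvec (sandwich W v) = reversal W * cvec v * W" for v
    by (metis sandwich_eqI)
  then show "cvec (sandwich W v) = reversal W * cvec v * W" .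
  show "linear (sandwich W)"
  proof (rule linearI)
    fix x y and c :: real
    have "cvec (sandwich W (x + y)) = cvec (sandwich W x + sandwich W y)"
      by (simp add: * cvec_linear distrib_left distrib_right)
    then show "sandwich W (x + y) = sandwich W x + sandwich W y"
      by (simp only: cvec_inject)
    have "cvec (sandwich W (c *\<^sub>R x)) = cvec (c *\<^sub>R sandwich W x)"
      by (simp add: * cvec_linear)
    then show "sandwich W (c *\<^sub>R x) = c *\<^sub>R sandwich W x"
      by (simp only: cvec_inject)
  qed
qed

section \<open>The normal form of the versor\<close>

definition D6_versor :: "(nat \<Rightarrow> real ^ 'n::{finite,linorder}) \<Rightarrow> 'n clifford" where
  "D6_versor u = cl_exp ((pi / 10) *\<^sub>R (cvec (u 0) * cvec (u 1))) *
     cl_exp ((3 * pi / 10) *\<^sub>R (cvec (u 2) * cvec (u 3))) * (cvec (u 4) * cvec (u 5))"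

text \<open>
  The bivector \<open>u 4 u 5\<close> is itself a rotor, of angle \<open>pi / 2\<close>, so all three factors are treated
  alike; each rotates its own plane and fixes the other two.
\<close>

lemma D6_versor_action:
  fixes u :: "nat \<Rightarrow> real ^ 'n::{finite,linorder}"
  assumes u: "orthonormal_frame 6 u"
  defines "W \<equiv> D6_versor u"
  shows "W \<in> unit_versors"
    and "reversal W * cvec (u 0) * W = cvec (cos (pi / 5) *\<^sub>R u 0 + sin (pi / 5) *\<^sub>R u 1)"
    and "reversal W * cvec (u 1) * W = cvec (- sin (pi / 5) *\<^sub>R u 0 + cos (pi / 5) *\<^sub>R u 1)"
    and "reversal W * cvec (u 2) * W = cvec (cos (3 * pi / 5) *\<^sub>R u 2 + sin (3 * pi / 5) *\<^sub>R u 3)"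
    and "reversal W * cvec (u 3) * W = cvec (- sin (3 * pi / 5) *\<^sub>R u 2 + cos (3 * pi / 5) *\<^sub>R u 3)"
    and "reversal W * cvec (u 4) * W = cvec (- u 4)"
    and "reversal W * cvec (u 5) * W = cvec (- u 5)"
proof -
  note unit = orthonormal_frameD(1)[OF u] and orth = orthonormal_frameD(2)[OF u]
  interpret R1: rotor "u 0" "u 1" "pi / 10"
    by unfold_locales (simp_all add: unit orth)
  interpret R2: rotor "u 2" "u 3" "3 * pi / 10"
    by unfold_locales (simp_all add: unit orth)
  interpret R3: rotor "u 4" "u 5" "pi / 2"
    by unfold_locales (simp_all add: unit orth)
  have W: "W = R1.R * R2.R * R3.R"
    by (simp add: W_def D6_versor_def R3.R_eq)
  have fixed:
    "reversal R1.R * cvec (a *\<^sub>R u i + b *\<^sub>R u j) * R1.R = cvec (a *\<^sub>R u i + b *\<^sub>R u j)"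
    if "i \<in> {2,3,4,5}" "j \<in> {2,3,4,5}" for a b i j
    using that by (intro R1.conj_orthogonal) (auto simp: orthogonal_clauses orth)
  have fixed2:
    "reversal R2.R * cvec (a *\<^sub>R u i + b *\<^sub>R u j) * R2.R = cvec (a *\<^sub>R u i + b *\<^sub>R u j)"
    if "i \<in> {0,1,4,5}" "j \<in> {0,1,4,5}" for a b i j
    using that by (intro R2.conj_orthogonal) (auto simp: orthogonal_clauses orth)
  have fixed3:
    "reversal R3.R * cvec (a *\<^sub>R u i + b *\<^sub>R u j) * R3.R = cvec (a *\<^sub>R u i + b *\<^sub>R u j)"
    if "i \<in> {0,1,2,3}" "j \<in> {0,1,2,3}" for a b i j
    using that by (intro R3.conj_orthogonal) (auto simp: orthogonal_clauses orth)
  show "W \<in> unit_versors"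
    unfolding W by (intro unit_versors_mult R1.R_unit R2.R_unit R3.R_unit)
  have angles: "2 * (pi / 10) = pi / 5" "2 * (3 * pi / 10) = 3 * pi / 5" "2 * (pi / 2) = pi"
    by simp_all
  note conj = R1.conj_u R1.conj_v R2.conj_u R2.conj_v R3.conj_u R3.conj_v
  note conj = conj[unfolded angles]
  show "reversal W * cvec (u 0) * W = cvec (cos (pi / 5) *\<^sub>R u 0 + sin (pi / 5) *\<^sub>R u 1)"
    unfolding W reversal_conj_mult conj by (simp only: fixed2 fixed3 insert_iff simp_thms)
  show "reversal W * cvec (u 1) * W = cvec (- sin (pi / 5) *\<^sub>R u 0 + cos (pi / 5) *\<^sub>R u 1)"
    unfolding W reversal_conj_mult conj by (simp only: fixed2 fixed3 insert_iff simp_thms)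
  show "reversal W * cvec (u 2) * W = cvec (cos (3 * pi / 5) *\<^sub>R u 2 + sin (3 * pi / 5) *\<^sub>R u 3)"
    using fixed[of 2 2 1 0] unfolding W reversal_conj_mult
    by (simp only: scaleR_one scaleR_zero_left add_0_right insert_iff simp_thms conj fixed3)
  show "reversal W * cvec (u 3) * W = cvec (- sin (3 * pi / 5) *\<^sub>R u 2 + cos (3 * pi / 5) *\<^sub>R u 3)"
    using fixed[of 3 3 1 0] unfolding W reversal_conj_mult
    by (simp only: scaleR_one scaleR_zero_left add_0_right insert_iff simp_thms conj fixed3)
  show "reversal W * cvec (u 4) * W = cvec (- u 4)"
    using fixed[of 4 4 1 0] fixed2[of 4 4 1 0] conj(5) unfolding W reversal_conj_mult
    by simp
  show "reversal W * cvec (u 5) * W = cvec (- u 5)"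
    using fixed[of 5 5 1 0] fixed2[of 5 5 1 0] conj(6) unfolding W reversal_conj_mult
    by simp
qed

lemma all_less_6: "(\<forall>i<6. P i) \<longleftrightarrow> P 0 \<and> P 1 \<and> P 2 \<and> P 3 \<and> P 4 \<and> P (5::nat)"
proof -
  have "i < 6 \<longleftrightarrow> i = 0 \<or> i = 1 \<or> i = 2 \<or> i = 3 \<or> i = 4 \<or> i = 5" for i :: nat
    by arith
  then show ?thesis by auto
qed

definition is_D6_versor :: "'n::{finite,linorder} clifford \<Rightarrow> bool" where
  "is_D6_versor W \<longleftrightarrow> (\<exists>u. orthonormal_frame 6 u \<and> W = D6_versor u)"

text \<open>
  Exchanging \<open>u 4\<close> and \<open>u 5\<close> reverses the orientation of the third plane; this is why signs can be
  ignored below.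
\<close>

lemma is_D6_versor_minus:
  assumes "is_D6_versor W"
  shows "is_D6_versor (- W)"
proof -
  obtain u where u: "orthonormal_frame 6 u" "W = D6_versor u"
    using assms by (auto simp: is_D6_versor_def)
  have "orthonormal_frame 6 (u(4 := u 5, 5 := u 4))"
    using u(1) unfolding orthonormal_frame_def all_less_6 by simp
  moreover have "- W = D6_versor (u(4 := u 5, 5 := u 4))"
    using cvec_orthogonal[OF orthonormal_frameD(2)[OF u(1), of 4 5]] u(2)
    by (simp add: D6_versor_def)
  ultimately show ?thesis
    unfolding is_D6_versor_def by blast
qed

text \<open>
  Conjugation by \<open>a\<close> is an automorphism of the algebra that maps vectors isometrically to vectors,
  hence it carries a normal form for \<open>u\<close> to the normal form for the image of \<open>u\<close>.
\<close>

lemma is_D6_versor_conj: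
  fixes a :: "real ^ 'n::{finite,linorder}"
  assumes a: "norm a = 1" and W: "is_D6_versor W"
  shows "is_D6_versor (cvec a * W * cvec a)"
proof -
  obtain u where u: "orthonormal_frame 6 u" and W: "W = D6_versor u"
    using W by (auto simp: is_D6_versor_def)
  have aa: "cvec a * cvec a = 1" "cvec a * (cvec a * x) = x" for x
    using cvec_unit[OF a] by (simp_all flip: mult.assoc)
  define r where "r v = (2 * (a \<bullet> v)) *\<^sub>R a - v" for v
  have r: "cvec (r v) = cvec a * cvec v * cvec a" for v
    by (simp add: r_def cvec_conj[OF a])
  have "a \<bullet> a = 1" using a by (simp add: norm_eq_1)
  then have inner: "r v \<bullet> r w = v \<bullet> w" for v w
    by (simp add: r_def inner_diff_left inner_diff_right inner_commute)
  have frame: "orthonormal_frame 6 (\<lambda>k. r (u k))"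
    using u by (simp add: orthonormal_frame_def inner)
  have bivector: "cvec (r v) * cvec (r w) = cvec a * (cvec v * cvec w) * cvec a" for v w
    by (simp add: r mult.assoc aa)
  have exp: "cl_exp (\<theta> *\<^sub>R (cvec (r (u i)) * cvec (r (u j)))) =
      cvec a * cl_exp (\<theta> *\<^sub>R (cvec (u i) * cvec (u j))) * cvec a"
    if "i < 6" "j < 6" "i \<noteq> j" for \<theta> i j
  proof -
    interpret R: rotor "u i" "u j" \<theta>
      using that by unfold_locales (simp_all add: orthonormal_frameD[OF u])
    interpret R': rotor "r (u i)" "r (u j)" \<theta>
      using that by unfold_locales (simp_all add: orthonormal_frameD[OF frame])
    show ?thesis
      unfolding R.R_eq R'.R_eq[unfolded bivector] bivector by (simp add: distrib_left distrib_right aa)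
  qed
  have "D6_versor (\<lambda>k. r (u k)) = cvec a * W * cvec a"
    unfolding D6_versor_def W
    by (subst exp[of 0 1], simp, simp, simp, subst exp[of 2 3], simp, simp, simp)
      (simp add: bivector mult.assoc aa)
  with frame show ?thesis
    unfolding is_D6_versor_def by metis
qed

section \<open>Diagonalising the negative five-cycle\<close>

lemma sum_fifth_roots:
  fixes j :: int
  shows "(\<Sum>k<5. cos (real_of_int j * real k * (2 * pi / 5))) = (if 5 dvd j then 5 else 0)" (is ?C)
    and "(\<Sum>k<5. sin (real_of_int j * real k * (2 * pi / 5))) = 0" (is ?S)
proof -
  define z where "z = cis (real_of_int j * (2 * pi / 5))"
  have pow: "z ^ k = cis (real_of_int j * real k * (2 * pi / 5))" for k
    unfolding z_def Complex.DeMoivre by (simp add: mult.commute mult.left_commute)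
  have z5: "z ^ 5 = 1"
    unfolding pow using cis_multiple_2pi[of "real_of_int j"] by (simp add: ac_simps)
  have z1: "z = 1 \<longleftrightarrow> 5 dvd j"
  proof
    assume "z = 1"
    then have "cos (real_of_int j * (2 * pi / 5)) = 1"
      by (simp add: z_def complex_eq_iff)
    then obtain n :: int where "real_of_int j * (2 * pi / 5) = real_of_int n * 2 * pi"
      unfolding cos_one_2pi_int by blast
    then have "real_of_int j = real_of_int (5 * n)"
      by (simp add: field_simps)
    then have "j = 5 * n"
      by (simp only: of_int_eq_iff)
    then show "5 dvd j" by simp
  next
    assume "5 dvd j"
    then obtain n where "j = 5 * n" ..
    then show "z = 1"
      unfolding z_def using cis_multiple_2pi[of "real_of_int n"] by (simp add: ac_simps)
  qed
  have "(\<Sum>k<5. z ^ k) = (if 5 dvd j then 5 else 0)"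
  proof (cases "z = 1")
    case True
    then show ?thesis using z1 by simp
  next
    case False
    then show ?thesis using z1 z5 by (simp add: sum_gp_strict)
  qed
  then have "(\<Sum>k<5. cis (real_of_int j * real k * (2 * pi / 5))) = (if 5 dvd j then 5 else 0)"
    by (simp only: pow)
  then have "Re (\<Sum>k<5. cis (real_of_int j * real k * (2 * pi / 5))) = (if 5 dvd j then 5 else 0)"
    "Im (\<Sum>k<5. cis (real_of_int j * real k * (2 * pi / 5))) = 0"
    by simp_all
  then show ?C ?S
    unfolding Re_sum Im_sum cis.sel by blast+
qed

text \<open>
  By the product formulas these are sums of \<open>cos\<close> and \<open>sin\<close> at the frequencies \<open>m + n\<close> and \<open>m - n\<close>.
  Both are even, so they run through fifth roots of unity, although the frequencies
  \<open>m\<close> and \<open>n\<close> themselves belong to tenth roots.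
\<close>

lemma trig_orthogonality:
  fixes m n :: int
  assumes "odd m" "odd n"
  defines "\<alpha> \<equiv> (\<lambda>m k. real_of_int m * real k * (pi / 5))"
  shows "(\<Sum>k<5. cos (\<alpha> m k) * cos (\<alpha> n k)) =
      ((if 10 dvd m - n then 5 else 0) + (if 10 dvd m + n then 5 else 0)) / 2" (is ?cc)
    and "(\<Sum>k<5. sin (\<alpha> m k) * sin (\<alpha> n k)) =
      ((if 10 dvd m - n then 5 else 0) - (if 10 dvd m + n then 5 else 0)) / 2" (is ?ss)
    and "(\<Sum>k<5. sin (\<alpha> m k) * cos (\<alpha> n k)) = 0" (is ?sc)
    and "(\<Sum>k<5. cos (\<alpha> m k) * sin (\<alpha> n k)) = 0" (is ?cs)
proof -
  define p where "p = (m + n) div 2"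
  define q where "q = (m - n) div 2"
  have pq: "m + n = 2 * p" "m - n = 2 * q"
    using assms by (auto simp: p_def q_def)
  then have "real_of_int m + real_of_int n = 2 * real_of_int p"
    "real_of_int m - real_of_int n = 2 * real_of_int q"
    by linarith+
  then have diff: "\<alpha> m k - \<alpha> n k = real_of_int q * real k * (2 * pi / 5)"
    and sum: "\<alpha> m k + \<alpha> n k = real_of_int p * real k * (2 * pi / 5)" for k
    unfolding \<alpha>_def by (simp_all flip: distrib_right left_diff_distrib)
  have dvd: "10 dvd m + n \<longleftrightarrow> 5 dvd p" "10 dvd m - n \<longleftrightarrow> 5 dvd q"
    unfolding pq by presburger+
  note simps = diff sum sum_fifth_roots dvd sum.distrib sum_subtractf
    sum_divide_distrib[symmetric]
  show ?cc unfolding cos_times_cos by (simp only: simps)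
  show ?ss unfolding sin_times_sin by (simp only: simps)
  show ?sc unfolding sin_times_cos by (simp only: simps) simp
  show ?cs unfolding cos_times_sin by (simp only: simps) simp
qed

lemma sum_lessThan_5: "(\<Sum>k<5. F k) = F 0 + F 1 + F 2 + F 3 + F (4::nat)"
  for F :: "nat \<Rightarrow> 'a::comm_monoid_add"
proof -
  have "{..<5} = {0,1,2,3,4::nat}" by auto
  then show ?thesis by (simp add: add.assoc)
qed

text \<open>
  The negative cycle \<open>f 0, ..., f 4, - f 0, ...\<close> has order \<open>10\<close>, and its eigenvalues are the tenth
  roots of unity whose fifth power is \<open>-1\<close>. The discrete Fourier vectors \<open>C m\<close>, \<open>S m\<close> with \<open>m\<close> odd
  are therefore well adapted to it: the step shifts the phase by \<open>m * pi / 5\<close>, and the sign at the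
  wrap-around matches \<open>cos (m * pi) = -1\<close>. The frequencies \<open>1\<close> and \<open>3\<close> give planes, \<open>5\<close> gives a
  vector, which together with \<open>f 5\<close> spans the plane rotated by \<open>pi\<close>.
\<close>

lemma signed_cycle_imp_D6_versor:
  fixes f :: "nat \<Rightarrow> real ^ 'n::{finite,linorder}"
  assumes dim: "CARD('n) = 6" and f: "orthonormal_frame 6 f" and W: "W \<in> unit_versors"
    and step: "\<And>k. k < 4 \<Longrightarrow> reversal W * cvec (f k) * W = cvec (f (Suc k))"
    and wrap: "reversal W * cvec (f 4) * W = cvec (- f 0)"
    and last: "reversal W * cvec (f 5) * W = cvec (- f 5)"
  shows "is_D6_versor W"
proof -
  define \<alpha> where "\<alpha> = (\<lambda>(m::int) k. real_of_int m * real k * (pi / 5))"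
  define C where "C m = (\<Sum>k<5. cos (\<alpha> m k) *\<^sub>R f k)" for m
  define S where "S m = (\<Sum>k<5. sin (\<alpha> m k) *\<^sub>R f k)" for m
  define T where "T v = reversal W * cvec v * W" for v
  have T: "linear T"
    unfolding T_def by (rule linear_conj_cvec)
  have nums: "Suc 0 = 1" "Suc 1 = 2" "Suc 2 = 3" "Suc 3 = 4"
    by simp_all
  have Tf: "T (f 0) = cvec (f 1)" "T (f 1) = cvec (f 2)" "T (f 2) = cvec (f 3)"
    "T (f 3) = cvec (f 4)" "T (f 4) = cvec (- f 0)" "T (f 5) = cvec (- f 5)"
    using step[of 0] step[of 1] step[of 2] step[of 3] wrap last
    unfolding nums T_def by simp_all
  have TC: "T (C m) = cvec (cos (\<alpha> m 1) *\<^sub>R C m + sin (\<alpha> m 1) *\<^sub>R S m)"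
    and TS: "T (S m) = cvec (- sin (\<alpha> m 1) *\<^sub>R C m + cos (\<alpha> m 1) *\<^sub>R S m)"
    if "odd m" for m
  proof -
    have suc: "\<alpha> m k = \<alpha> m (Suc k) - \<alpha> m 1" for k
      by (simp add: \<alpha>_def algebra_simps)
    have "\<alpha> m 4 + \<alpha> m 1 = real_of_int m * pi"
      by (simp add: \<alpha>_def algebra_simps)
    then have four: "\<alpha> m 4 = real_of_int m * pi - \<alpha> m 1"
      by simp
    have "cos (real_of_int m * pi) = -1" "sin (real_of_int m * pi) = 0"
      using that by (simp_all add: mult.commute[of _ pi])
    then have c4: "cos (\<alpha> m 4) = - cos (\<alpha> m 1)" and s4: "sin (\<alpha> m 4) = sin (\<alpha> m 1)"
      unfolding four by (simp_all add: cos_diff sin_diff)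
    have z: "\<alpha> m 0 = 0" by (simp add: \<alpha>_def)
    have c_step: "cos (\<alpha> m k) = cos (\<alpha> m 1) * cos (\<alpha> m (Suc k)) + sin (\<alpha> m 1) * sin (\<alpha> m (Suc k))"
      and s_step: "sin (\<alpha> m k) = cos (\<alpha> m 1) * sin (\<alpha> m (Suc k)) - sin (\<alpha> m 1) * cos (\<alpha> m (Suc k))" for k
      using arg_cong[OF suc[of k], of cos] arg_cong[OF suc[of k], of sin]
      by (simp_all only: cos_diff sin_diff mult.commute add.commute)
    note c = c_step[of 0, unfolded nums] c_step[of 1, unfolded nums]
      c_step[of 2, unfolded nums] c_step[of 3, unfolded nums]
    note s = s_step[of 0, unfolded nums] s_step[of 1, unfolded nums]
      s_step[of 2, unfolded nums] s_step[of 3, unfolded nums]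
    have "T (C m) = cvec (cos (\<alpha> m 0) *\<^sub>R f 1 + cos (\<alpha> m 1) *\<^sub>R f 2 + cos (\<alpha> m 2) *\<^sub>R f 3 +
        cos (\<alpha> m 3) *\<^sub>R f 4 + (- cos (\<alpha> m 4)) *\<^sub>R f 0)"
      by (simp add: C_def sum_lessThan_5 linear_add[OF T] linear_scale[OF T] Tf cvec_linear del: One_nat_def)
    also have "cos (\<alpha> m 0) *\<^sub>R f 1 + cos (\<alpha> m 1) *\<^sub>R f 2 + cos (\<alpha> m 2) *\<^sub>R f 3 +
        cos (\<alpha> m 3) *\<^sub>R f 4 + (- cos (\<alpha> m 4)) *\<^sub>R f 0 =
        (cos (\<alpha> m 1) * cos (\<alpha> m 1) + sin (\<alpha> m 1) * sin (\<alpha> m 1)) *\<^sub>R f 1 +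
        (cos (\<alpha> m 1) * cos (\<alpha> m 2) + sin (\<alpha> m 1) * sin (\<alpha> m 2)) *\<^sub>R f 2 +
        (cos (\<alpha> m 1) * cos (\<alpha> m 3) + sin (\<alpha> m 1) * sin (\<alpha> m 3)) *\<^sub>R f 3 +
        (cos (\<alpha> m 1) * cos (\<alpha> m 4) + sin (\<alpha> m 1) * sin (\<alpha> m 4)) *\<^sub>R f 4 +
        cos (\<alpha> m 1) *\<^sub>R f 0"
      unfolding c[symmetric] by (simp only: c4 minus_minus)
    also have "\<dots> = cos (\<alpha> m 1) *\<^sub>R C m + sin (\<alpha> m 1) *\<^sub>R S m"
      unfolding C_def S_def sum_lessThan_5 z by (simp add: algebra_simps del: One_nat_def sin_cos_squared_add3 sin_cos_squared_add sin_cos_squared_add2)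
    finally show "T (C m) = cvec (cos (\<alpha> m 1) *\<^sub>R C m + sin (\<alpha> m 1) *\<^sub>R S m)" .
    have "T (S m) = cvec (sin (\<alpha> m 0) *\<^sub>R f 1 + sin (\<alpha> m 1) *\<^sub>R f 2 + sin (\<alpha> m 2) *\<^sub>R f 3 +
        sin (\<alpha> m 3) *\<^sub>R f 4 + (- sin (\<alpha> m 4)) *\<^sub>R f 0)"
      by (simp add: S_def sum_lessThan_5 linear_add[OF T] linear_scale[OF T] Tf cvec_linear del: One_nat_def)
    also have "sin (\<alpha> m 0) *\<^sub>R f 1 + sin (\<alpha> m 1) *\<^sub>R f 2 + sin (\<alpha> m 2) *\<^sub>R f 3 +
        sin (\<alpha> m 3) *\<^sub>R f 4 + (- sin (\<alpha> m 4)) *\<^sub>R f 0 =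
        (cos (\<alpha> m 1) * sin (\<alpha> m 1) - sin (\<alpha> m 1) * cos (\<alpha> m 1)) *\<^sub>R f 1 +
        (cos (\<alpha> m 1) * sin (\<alpha> m 2) - sin (\<alpha> m 1) * cos (\<alpha> m 2)) *\<^sub>R f 2 +
        (cos (\<alpha> m 1) * sin (\<alpha> m 3) - sin (\<alpha> m 1) * cos (\<alpha> m 3)) *\<^sub>R f 3 +
        (cos (\<alpha> m 1) * sin (\<alpha> m 4) - sin (\<alpha> m 1) * cos (\<alpha> m 4)) *\<^sub>R f 4 +
        (- sin (\<alpha> m 1)) *\<^sub>R f 0"
      unfolding s[symmetric] by (simp only: s4)
    also have "\<dots> = - sin (\<alpha> m 1) *\<^sub>R C m + cos (\<alpha> m 1) *\<^sub>R S m"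
      unfolding C_def S_def sum_lessThan_5 z by (simp add: algebra_simps del: One_nat_def sin_cos_squared_add3 sin_cos_squared_add sin_cos_squared_add2)
    finally show "T (S m) = cvec (- sin (\<alpha> m 1) *\<^sub>R C m + cos (\<alpha> m 1) *\<^sub>R S m)" .
  qed
  have inner: "(\<Sum>k<5. a k *\<^sub>R f k) \<bullet> (\<Sum>k<5. b k *\<^sub>R f k) = (\<Sum>k<5. a k * b k)"
    "(\<Sum>k<5. a k *\<^sub>R f k) \<bullet> f 5 = 0" "f 5 \<bullet> (\<Sum>k<5. a k *\<^sub>R f k) = 0" "f 5 \<bullet> f 5 = 1" for a b
    unfolding sum_lessThan_5
    by (simp_all add: inner_add_left inner_add_right orthonormal_frame_inner[OF f])
  have gram: "C m \<bullet> C n = ((if 10 dvd m - n then 5 else 0) + (if 10 dvd m + n then 5 else 0)) / 2"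
    "S m \<bullet> S n = ((if 10 dvd m - n then 5 else 0) - (if 10 dvd m + n then 5 else 0)) / 2"
    "C m \<bullet> S n = 0" "S m \<bullet> C n = 0" if "odd m" "odd n" for m n
    using trig_orthogonality[OF that] unfolding C_def S_def inner \<alpha>_def by blast+
  have gram5: "C m \<bullet> f 5 = 0" "S m \<bullet> f 5 = 0" "f 5 \<bullet> C m = 0" "f 5 \<bullet> S m = 0" for m
    unfolding C_def S_def by (rule inner)+
  \<comment> \<open>\<open>C m\<close> and \<open>S m\<close> have squared length \<open>5 / 2\<close>, except that \<open>C 5\<close> has squared length \<open>5\<close>.\<close>
  define u where "u k = [sqrt (2 / 5) *\<^sub>R C 1, sqrt (2 / 5) *\<^sub>R S 1, sqrt (2 / 5) *\<^sub>R C 3,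
    sqrt (2 / 5) *\<^sub>R S 3, sqrt (1 / 5) *\<^sub>R C 5, f 5] ! k" for k
  have u_simps: "u 0 = sqrt (2 / 5) *\<^sub>R C 1" "u 1 = sqrt (2 / 5) *\<^sub>R S 1"
    "u 2 = sqrt (2 / 5) *\<^sub>R C 3" "u 3 = sqrt (2 / 5) *\<^sub>R S 3"
    "u 4 = sqrt (1 / 5) *\<^sub>R C 5" "u 5 = f 5"
    by (simp_all add: u_def eval_nat_numeral)
  have sq: "sqrt (2 / 5) * (sqrt (2 / 5) * 5) = 2" "sqrt (1 / 5) * (sqrt (1 / 5) * 5) = 1"
    unfolding mult.assoc[symmetric] real_sqrt_mult_self by simp_all
  have frame: "orthonormal_frame 6 u"
    unfolding orthonormal_frame_def all_less_6 u_simps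
    by (simp add: gram gram5 inner sq)
  have "sin (\<alpha> 5 k) = 0" for k
    by (simp add: \<alpha>_def)
  then have S5: "S 5 = 0"
    by (simp add: S_def)
  have \<alpha>1: "\<alpha> 1 1 = pi / 5" "\<alpha> 3 1 = 3 * pi / 5" "\<alpha> 5 1 = pi"
    by (simp_all add: \<alpha>_def)
  have odd: "odd (1 :: int)" "odd (3 :: int)" "odd (5 :: int)"
    by simp_all
  have Tu: "T (u 0) = cvec (cos (pi / 5) *\<^sub>R u 0 + sin (pi / 5) *\<^sub>R u 1)"
    "T (u 1) = cvec (- sin (pi / 5) *\<^sub>R u 0 + cos (pi / 5) *\<^sub>R u 1)"
    "T (u 2) = cvec (cos (3 * pi / 5) *\<^sub>R u 2 + sin (3 * pi / 5) *\<^sub>R u 3)"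
    "T (u 3) = cvec (- sin (3 * pi / 5) *\<^sub>R u 2 + cos (3 * pi / 5) *\<^sub>R u 3)"
    "T (u 4) = cvec (- u 4)" "T (u 5) = cvec (- u 5)"
    unfolding u_simps linear_scale[OF T] TC[OF odd(1)] TC[OF odd(2)] TC[OF odd(3)] TS[OF odd(1)] TS[OF odd(2)]
      \<alpha>1 Tf(6)
    by (simp_all add: cvec_linear algebra_simps S5)
  let ?V = "D6_versor u"
  note V = D6_versor_action[OF frame]
  have "reversal W * cvec v * W = reversal ?V * cvec v * ?V" for v
  proof (rule linear_eq_on[OF linear_conj_cvec[of W] linear_conj_cvec[of ?V], where B = "u ` {..<6}"])
    have "DIM(real ^ 'n::{finite,linorder}) = 6" using dim by simp
    then show "v \<in> span (u ` {..<6})"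
      using orthonormal_frame_span[of u] frame by simp
  next
    fix x assume "x \<in> u ` {..<6}"
    then obtain k where x: "x = u k" and "k < 6" by auto
    have "\<forall>k<6. T (u k) = reversal ?V * cvec (u k) * ?V"
      unfolding all_less_6 V Tu by blast
    then show "reversal W * cvec x * W = reversal ?V * cvec x * ?V"
      using \<open>k < 6\<close> by (simp add: x T_def)
  qed
  then have "W = ?V \<or> W = - ?V"
    by (rule versor_determined_by_action[OF W V(1), rotated]) (simp add: dim)
  moreover have "is_D6_versor ?V"
    using frame by (auto simp: is_D6_versor_def)
  ultimately show ?thesis
    by (metis is_D6_versor_minus)
qed

section \<open>Simple systems of type D\<close>

text \<open>
  The functional equal to \<open>1\<close> on the simple roots is the height; it recovers the positive
  roots as those on which it is positive.
\<close>

lemma simple_system_functional: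
  fixes \<Delta> :: "'a::euclidean_space set"
  assumes simple: "simple_system \<Phi> \<Delta>" and nz: "0 \<notin> \<Phi>"
  obtains g :: "'a \<Rightarrow> real" where "linear g" "\<And>\<alpha>. \<alpha> \<in> \<Delta> \<Longrightarrow> g \<alpha> = 1" "\<And>\<beta>. \<beta> \<in> \<Phi> \<Longrightarrow> g \<beta> \<noteq> 0"
    "\<And>\<beta>. \<beta> \<in> \<Phi> \<Longrightarrow> g \<beta> > 0 \<Longrightarrow> \<exists>c. \<beta> = (\<Sum>\<alpha>\<in>\<Delta>. c \<alpha> *\<^sub>R \<alpha>) \<and> (\<forall>\<alpha>\<in>\<Delta>. c \<alpha> \<ge> 0)"
proof -
  have indep: "independent \<Delta>"
    using simple by (simp add: simple_system_def)
  then have fin: "finite \<Delta>"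
    by (rule finiteI_independent)
  obtain g :: "'a \<Rightarrow> real" where g: "linear g" and g1: "\<And>\<alpha>. \<alpha> \<in> \<Delta> \<Longrightarrow> g \<alpha> = 1"
    using linear_independent_extend[OF indep, of "\<lambda>_. 1"] by blast
  have g_sum: "g (\<Sum>\<alpha>\<in>\<Delta>. c \<alpha> *\<^sub>R \<alpha>) = (\<Sum>\<alpha>\<in>\<Delta>. c \<alpha>)" for c
    by (simp add: linear_sum[OF g] linear_scale[OF g] g1)
  show thesis
  proof (rule that[OF g g1])
    fix \<beta> assume \<beta>: "\<beta> \<in> \<Phi>"
    then obtain c where c: "\<beta> = (\<Sum>\<alpha>\<in>\<Delta>. c \<alpha> *\<^sub>R \<alpha>)"
      and sgn: "(\<forall>\<alpha>\<in>\<Delta>. c \<alpha> \<ge> 0) \<or> (\<forall>\<alpha>\<in>\<Delta>. c \<alpha> \<le> 0)"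
      using simple unfolding simple_system_def by blast
    show "g \<beta> \<noteq> 0"
    proof
      assume "g \<beta> = 0"
      then have "sum c \<Delta> = 0" by (simp add: c g_sum)
      have "\<forall>\<alpha>\<in>\<Delta>. c \<alpha> = 0"
      proof (rule disjE[OF sgn])
        assume "\<forall>\<alpha>\<in>\<Delta>. c \<alpha> \<ge> 0"
        with \<open>sum c \<Delta> = 0\<close> show ?thesis
          using sum_nonneg_eq_0_iff[OF fin, of c] by simp
      next
        assume "\<forall>\<alpha>\<in>\<Delta>. c \<alpha> \<le> 0"
        with \<open>sum c \<Delta> = 0\<close> show ?thesis
          using sum_nonneg_eq_0_iff[OF fin, of "\<lambda>\<alpha>. - c \<alpha>"] by (simp add: sum_negf)
      qed
      then have "\<beta> = 0" by (simp add: c)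
      then show False using \<beta> nz by blast
    qed
    assume pos: "g \<beta> > 0"
    have "\<not> (\<forall>\<alpha>\<in>\<Delta>. c \<alpha> \<le> 0)"
      using pos sum_nonpos[of \<Delta> c] unfolding c g_sum by fastforce
    then show "\<exists>c. \<beta> = (\<Sum>\<alpha>\<in>\<Delta>. c \<alpha> *\<^sub>R \<alpha>) \<and> (\<forall>\<alpha>\<in>\<Delta>. c \<alpha> \<ge> 0)"
      using c sgn by blast
  qed
qed

text \<open>
  By linear independence both summands are multiples of \<open>\<alpha>\<close> with coefficients adding up to \<open>1\<close>.
  If all roots have the same length this is impossible for roots \<open>\<beta>\<close> and \<open>\<gamma>\<close>.
\<close>

lemma simple_root_indecomposable:
  fixes \<Delta> :: "'a::euclidean_space set"
  assumes indep: "independent \<Delta>" and \<alpha>: "\<alpha> \<in> \<Delta>" and sum: "\<alpha> = \<beta> + \<gamma>"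
    and \<beta>: "\<beta> = (\<Sum>\<delta>\<in>\<Delta>. c \<delta> *\<^sub>R \<delta>)" "\<And>\<delta>. \<delta> \<in> \<Delta> \<Longrightarrow> c \<delta> \<ge> 0"
    and \<gamma>: "\<gamma> = (\<Sum>\<delta>\<in>\<Delta>. d \<delta> *\<^sub>R \<delta>)" "\<And>\<delta>. \<delta> \<in> \<Delta> \<Longrightarrow> d \<delta> \<ge> 0"
  shows "norm \<beta> < norm \<alpha> \<or> norm \<gamma> < norm \<alpha>"
proof -
  have fin: "finite \<Delta>"
    using indep by (rule finiteI_independent)
  have "\<alpha> = (\<Sum>\<delta>\<in>\<Delta>. (if \<delta> = \<alpha> then 1 else 0) *\<^sub>R \<delta>)"
    using fin \<alpha> by (simp add: if_distrib[of "\<lambda>t. t *\<^sub>R _"] cong: if_cong)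
  then have "(\<Sum>\<delta>\<in>\<Delta>. (c \<delta> + d \<delta> - (if \<delta> = \<alpha> then 1 else 0)) *\<^sub>R \<delta>) = 0"
    using sum \<beta>(1) \<gamma>(1) by (simp add: scaleR_diff_left scaleR_add_left sum_subtractf sum.distrib)
  then have coeff: "c \<delta> + d \<delta> - (if \<delta> = \<alpha> then 1 else 0) = 0" if "\<delta> \<in> \<Delta>" for \<delta>
    using independentD[OF indep fin order_refl, of "\<lambda>\<delta>. c \<delta> + d \<delta> - (if \<delta> = \<alpha> then 1 else 0)"] that
    by blast
  have zero: "c \<delta> = 0" "d \<delta> = 0" if "\<delta> \<in> \<Delta> - {\<alpha>}" for \<delta>
    using coeff[of \<delta>] \<beta>(2)[of \<delta>] \<gamma>(2)[of \<delta>] that by auto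
  have "\<beta> = c \<alpha> *\<^sub>R \<alpha>" "\<gamma> = d \<alpha> *\<^sub>R \<alpha>"
    unfolding \<beta>(1) \<gamma>(1) sum.remove[OF fin \<alpha>] by (simp_all add: zero)
  moreover have "c \<alpha> + d \<alpha> = 1" "c \<alpha> \<ge> 0" "d \<alpha> \<ge> 0"
    using coeff[OF \<alpha>] \<beta>(2)[OF \<alpha>] \<gamma>(2)[OF \<alpha>] by simp_all
  moreover have "norm \<alpha> > 0"
    using indep \<alpha> dependent_zero by fastforce
  ultimately show ?thesis
    by (cases "c \<alpha> < 1") simp_all
qed

lemma D_root_norm: "\<beta> \<in> D_roots \<Longrightarrow> norm \<beta> = sqrt 2"
  by (auto simp: D_roots_def norm_eq_sqrt_inner inner_add_left inner_add_right
      inner_diff_left inner_diff_right inner_axis_axis)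

lemma span_D_roots:
  assumes "CARD('n::finite) \<ge> 2"
  shows "span (D_roots :: (real ^ 'n) set) = UNIV"
proof -
  have "axis i 1 \<in> span (D_roots :: (real ^ 'n) set)" for i
  proof -
    have "(UNIV :: 'n set) \<noteq> {i}"
    proof
      assume "(UNIV :: 'n set) = {i}"
      then have "CARD('n) = card {i}" by (rule arg_cong)
      then show False using assms by simp
    qed
    then obtain j where j: "j \<noteq> i" by blast
    have "1 *\<^sub>R axis i 1 + 1 *\<^sub>R axis j 1 \<in> (D_roots :: (real ^ 'n) set)"
      "1 *\<^sub>R axis i 1 + (-1) *\<^sub>R axis j 1 \<in> (D_roots :: (real ^ 'n) set)"
      unfolding D_roots_def using j by blast+
    then have "(1 / 2) *\<^sub>R ((1 *\<^sub>R axis i 1 + 1 *\<^sub>R axis j 1) + (1 *\<^sub>R axis i 1 + (-1) *\<^sub>R axis j 1)) \<in>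
        span (D_roots :: (real ^ 'n) set)"
      by (intro span_scale span_add span_base)
    then show ?thesis
      by (simp flip: scaleR_2)
  qed
  then have "Basis \<subseteq> span (D_roots :: (real ^ 'n) set)"
    by (auto simp: Basis_vec_def)
  then have "span Basis \<subseteq> span (D_roots :: (real ^ 'n) set)"
    by (metis span_mono span_span)
  then show ?thesis by auto
qed

lemma decreasing_enumeration:
  fixes h :: "'n::finite \<Rightarrow> real"
  assumes "inj h"
  obtains x :: "nat \<Rightarrow> 'n" where "\<And>i j. i < j \<Longrightarrow> j < CARD('n) \<Longrightarrow> h (x j) < h (x i)"
    and "\<And>i. \<exists>k<CARD('n). x k = i"
proof -
  define L where "L = rev (sorted_list_of_set (range h))"
  have len: "length L = CARD('n)"
    by (simp add: L_def card_image[OF assms])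
  have set: "set L = range h"
    by (simp add: L_def)
  have sorted: "sorted_wrt (\<lambda>x y. y < x) L"
    by (simp add: L_def sorted_wrt_rev)
  define x where "x k = inv h (L ! k)" for k
  have hx: "h (x k) = L ! k" if "k < CARD('n)" for k
    using that set len nth_mem[of k L] by (simp add: x_def f_inv_into_f)
  show thesis
  proof
    show "h (x j) < h (x i)" if "i < j" "j < CARD('n)" for i j
      using sorted_wrt_nth_less[OF sorted that(1)] that by (simp add: len hx)
    show "\<exists>k<CARD('n). x k = i" for i
    proof -
      have "h i \<in> set L" by (simp add: set)
      then obtain k where "k < CARD('n)" "L ! k = h i"
        by (auto simp: in_set_conv_nth len)
      then show ?thesis
        using assms by (auto simp: x_def)
    qed
  qed
qed

definition D_simple_root :: "nat \<Rightarrow> (nat \<Rightarrow> 'a::real_vector) \<Rightarrow> nat \<Rightarrow> 'a" where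
  "D_simple_root n f k = (if Suc k < n then f k - f (Suc k) else f (n - 2) + f (n - 1))"

text \<open>
  All simple systems look alike. The height \<open>g\<close> takes values of different modulus on different
  axes, because it does not vanish on \<open>e i + e j\<close> and \<open>e i - e j\<close>. Ordering the axes by decreasing
  modulus and choosing signs gives a frame \<open>f\<close> in which the positive roots are \<open>f a - f b\<close> and
  \<open>f a + f b\<close> for \<open>a < b\<close>. Those not of the form \<open>D_simple_root n f k\<close> decompose
  into two positive roots, so the simple roots are of this form; none is missing, as the roots
  span the space.
\<close>

proposition D_simple_system:
  fixes \<Delta> :: "(real ^ 'n::finite) set"
  assumes simple: "simple_system D_roots \<Delta>" and n2: "CARD('n) \<ge> 2"
  obtains f where "orthonormal_frame CARD('n) f"
    and "\<Delta> = D_simple_root CARD('n) f ` {..<CARD('n)}" and "card \<Delta> = CARD('n)"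
proof -
  define n where "n = CARD('n)"
  have indep: "independent \<Delta>" and sub: "\<Delta> \<subseteq> D_roots"
    using simple by (auto simp: simple_system_def)
  have "0 \<notin> (D_roots :: (real ^ 'n) set)"
    using D_root_norm by fastforce
  then obtain g :: "real ^ 'n \<Rightarrow> real" where g: "linear g" and g1: "\<And>\<alpha>. \<alpha> \<in> \<Delta> \<Longrightarrow> g \<alpha> = 1"
    and g0: "\<And>\<beta>. \<beta> \<in> D_roots \<Longrightarrow> g \<beta> \<noteq> 0"
    and comb: "\<And>\<beta>. \<beta> \<in> D_roots \<Longrightarrow> g \<beta> > 0 \<Longrightarrow>
      \<exists>c. \<beta> = (\<Sum>\<alpha>\<in>\<Delta>. c \<alpha> *\<^sub>R \<alpha>) \<and> (\<forall>\<alpha>\<in>\<Delta>. c \<alpha> \<ge> 0)"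
    by (rule simple_system_functional[OF simple]) iprover
  note g_lin = linear_add[OF g] linear_diff[OF g] linear_scale[OF g]
  have decomp: False if "\<alpha> \<in> \<Delta>" "\<alpha> = \<beta> + \<gamma>" "\<beta> \<in> D_roots" "\<gamma> \<in> D_roots" "g \<beta> > 0" "g \<gamma> > 0"
    for \<alpha> \<beta> \<gamma>
  proof -
    obtain c d where "\<beta> = (\<Sum>\<delta>\<in>\<Delta>. c \<delta> *\<^sub>R \<delta>)" "\<forall>\<delta>\<in>\<Delta>. c \<delta> \<ge> 0"
      "\<gamma> = (\<Sum>\<delta>\<in>\<Delta>. d \<delta> *\<^sub>R \<delta>)" "\<forall>\<delta>\<in>\<Delta>. d \<delta> \<ge> 0"
      using comb \<open>\<beta> \<in> D_roots\<close> \<open>\<gamma> \<in> D_roots\<close> \<open>g \<beta> > 0\<close> \<open>g \<gamma> > 0\<close> by meson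
    then have "norm \<beta> < norm \<alpha> \<or> norm \<gamma> < norm \<alpha>"
      using simple_root_indecomposable[OF indep that(1,2)] by blast
    moreover have "\<alpha> \<in> D_roots"
      using sub \<open>\<alpha> \<in> \<Delta>\<close> by blast
    ultimately show False
      using that by (simp add: D_root_norm)
  qed
  define h where "h i = \<bar>g (axis i 1)\<bar>" for i
  have "inj h"
  proof (rule injI, rule ccontr)
    fix i j assume h: "h i = h j" and "i \<noteq> j"
    then have r: "1 *\<^sub>R axis i 1 + 1 *\<^sub>R axis j 1 \<in> (D_roots :: (real ^ 'n) set)"
      "1 *\<^sub>R axis i 1 + (-1) *\<^sub>R axis j 1 \<in> (D_roots :: (real ^ 'n) set)"
      unfolding D_roots_def by blast+
    show False
      using h g0[OF r(1)] g0[OF r(2)] by (auto simp: h_def g_lin abs_if split: if_splits)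
  qed
  obtain x where dec: "\<And>i j. i < j \<Longrightarrow> j < n \<Longrightarrow> h (x j) < h (x i)"
    and surj: "\<And>i. \<exists>k<n. x k = i"
    unfolding n_def by (rule decreasing_enumeration[OF \<open>inj h\<close>]) iprover
  define \<sigma> :: "'n \<Rightarrow> real" where "\<sigma> i = (if g (axis i 1) \<ge> 0 then 1 else -1)" for i
  define f :: "nat \<Rightarrow> real ^ 'n" where "f k = \<sigma> (x k) *\<^sub>R axis (x k) 1" for k
  have gf: "g (f k) = h (x k)" for k
    by (simp add: f_def \<sigma>_def h_def g_lin)
  have x_inj: "x i \<noteq> x j" if "i < n" "j < n" "i \<noteq> j" for i j
    using dec[of i j] dec[of j i] that by (cases "i < j") auto
  have frame: "orthonormal_frame n f"
    unfolding orthonormal_frame_def f_def using x_inj by (auto simp: inner_axis_axis \<sigma>_def)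
  have pos: "g (f a - f b) > 0" "g (f a + f b) > 0" if "a < b" "b < n" for a b
    using dec[OF that] by (auto simp: g_lin gf h_def)
  have rootI: "s *\<^sub>R f a + t *\<^sub>R f b \<in> D_roots"
    if "a < n" "b < n" "a \<noteq> b" "s \<in> {1, -1}" "t \<in> {1, -1}" for a b s t
  proof -
    have "s * \<sigma> (x a) \<in> {1, -1}" "t * \<sigma> (x b) \<in> {1, -1}"
      using that(4,5) by (auto simp: \<sigma>_def)
    then show ?thesis
      unfolding D_roots_def f_def scaleR_scaleR using x_inj[OF that(1-3)] by blast
  qed
  have root: "f a - f b \<in> D_roots" "f a + f b \<in> D_roots" if "a < b" "b < n" for a b
    using rootI[of a b 1 "-1"] rootI[of a b 1 1] that by auto
  have rootE: "\<exists>a b t. a < b \<and> b < n \<and> t \<in> {1, -1} \<and> \<beta> = f a + t *\<^sub>R f b"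
    if \<beta>: "\<beta> \<in> D_roots" and "g \<beta> > 0" for \<beta>
  proof -
    obtain s t i j where \<beta>: "\<beta> = s *\<^sub>R axis i 1 + t *\<^sub>R axis j 1" "i \<noteq> j" "s \<in> {1, -1}" "t \<in> {1, -1}"
      using \<beta> unfolding D_roots_def by blast
    obtain a b where ab: "a < n" "x a = i" "b < n" "x b = j"
      using surj by meson
    have "axis i 1 = \<sigma> i *\<^sub>R f a" "axis j 1 = \<sigma> j *\<^sub>R f b"
      using ab by (simp_all add: f_def \<sigma>_def)
    then have eq: "\<beta> = (s * \<sigma> i) *\<^sub>R f a + (t * \<sigma> j) *\<^sub>R f b"
      by (simp add: \<beta>(1))
    have units: "s * \<sigma> i \<in> {1, -1}" "t * \<sigma> j \<in> {1, -1}"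
      using \<beta>(3,4) by (auto simp: \<sigma>_def)
    have "a \<noteq> b" using ab \<beta>(2) by auto
    obtain a b s t where rep: "a < b" "b < n" "s \<in> {1, -1}" "t \<in> {1, -1}"
      "\<beta> = s *\<^sub>R f a + t *\<^sub>R f b"
    proof (cases "a < b")
      case True
      then show ?thesis using that[OF True _ units] ab eq by blast
    next
      case False
      then have "b < a" using \<open>a \<noteq> b\<close> by simp
      then show ?thesis using that[OF _ _ units(2,1), of b a] ab eq by (simp add: add.commute)
    qed
    have "s = 1"
    proof (rule ccontr)
      assume "s \<noteq> 1"
      then have "g \<beta> = - h (x a) + t * h (x b)"
        using rep by (simp add: g_lin gf)
      moreover have "t * h (x b) < h (x a)"
        using dec[OF rep(1,2)] rep(4) by (auto simp: h_def)
      ultimately show False using \<open>g \<beta> > 0\<close> by simp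
    qed
    with rep have "\<beta> = f a + t *\<^sub>R f b" by simp
    then show ?thesis using rep(1,2,4) by blast
  qed
  have "\<Delta> \<subseteq> D_simple_root n f ` {..<n}"
  proof
    fix \<alpha> assume \<alpha>: "\<alpha> \<in> \<Delta>"
    then obtain a b t where ab: "a < b" "b < n" and t: "t \<in> {1, -1}" and eq: "\<alpha> = f a + t *\<^sub>R f b"
      using rootE[of \<alpha>] sub g1[of \<alpha>] by auto
    consider "t = -1" "b = Suc a" | "t = -1" "Suc a < b" | "t = 1" "b < n - 1"
      | "t = 1" "b = n - 1" "a < n - 2" | "t = 1" "b = n - 1" "a = n - 2"
      using t ab by fastforce
    then show "\<alpha> \<in> D_simple_root n f ` {..<n}"
    proof cases
      case 1
      then have "\<alpha> = D_simple_root n f a" "a < n"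
        using ab eq by (simp_all add: D_simple_root_def)
      then show ?thesis by blast
    next
      case 2
      then have "\<alpha> = (f a - f (Suc a)) + (f (Suc a) - f b)"
        using eq by simp
      then have False
        by (rule decomp[OF \<alpha>]) (use 2 ab in \<open>simp_all add: root pos\<close>)
      then show ?thesis ..
    next
      case 3
      then have "\<alpha> = (f a - f (n - 1)) + (f b + f (n - 1))"
        using eq by simp
      then have False
        by (rule decomp[OF \<alpha>]) (use 3 ab in \<open>simp_all add: root pos\<close>)
      then show ?thesis ..
    next
      case 4
      then have "\<alpha> = (f a - f (n - 2)) + (f (n - 2) + f (n - 1))"
        using eq by simp
      then have False
        by (rule decomp[OF \<alpha>]) (use 4 ab in \<open>simp_all add: root pos\<close>)
      then show ?thesis ..
    next
      case 5
      then have "\<alpha> = D_simple_root n f (n - 1)" "n - 1 < n"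
        using ab eq by (simp_all add: D_simple_root_def)
      then show ?thesis by blast
    qed
  qed
  moreover have "card \<Delta> = n"
  proof -
    have "D_roots \<subseteq> span \<Delta>"
    proof
      fix \<beta> :: "real ^ 'n" assume "\<beta> \<in> D_roots"
      then obtain c where "\<beta> = (\<Sum>\<alpha>\<in>\<Delta>. c \<alpha> *\<^sub>R \<alpha>)"
        using simple unfolding simple_system_def by blast
      then show "\<beta> \<in> span \<Delta>"
        by (auto intro: span_sum span_scale span_base)
    qed
    then have "span \<Delta> = UNIV"
      using span_D_roots[OF n2] by (metis span_mono span_span top.extremum_unique)
    then show ?thesis
      using dim_span_eq_card_independent[OF indep] by (simp add: n_def)
  qed
  moreover have "card (D_simple_root n f ` {..<n}) \<le> n"
    using card_image_le[of "{..<n}"] by simp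
  ultimately have "\<Delta> = D_simple_root n f ` {..<n}"
    by (intro card_seteq) auto
  then show thesis
    using that frame \<open>card \<Delta> = n\<close> by (simp add: n_def)
qed

section \<open>Independence of the order of the factors\<close>

definition unit_vector_products :: "'n::{finite,linorder} clifford set" where
  "unit_vector_products = {prod_list (map cvec vs) | vs. \<forall>v\<in>set vs. norm v = 1}"

lemma unit_vector_products_mult:
  assumes "V \<in> unit_vector_products" "W \<in> unit_vector_products"
  shows "V * W \<in> unit_vector_products"
proof -
  obtain vs ws where "V = prod_list (map cvec vs)" "W = prod_list (map cvec ws)"
    "\<forall>v\<in>set vs. norm v = 1" "\<forall>v\<in>set ws. norm v = 1"
    using assms by (auto simp: unit_vector_products_def)
  then have "V * W = prod_list (map cvec (vs @ ws))" "\<forall>v\<in>set (vs @ ws). norm v = 1"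
    by auto
  then show ?thesis
    unfolding unit_vector_products_def by blast
qed

lemma unit_vector_products_one: "1 \<in> unit_vector_products"
  unfolding unit_vector_products_def by (auto intro!: exI[of _ "[]"])

lemma unit_vector_products_cvec: "norm v = 1 \<Longrightarrow> cvec v \<in> unit_vector_products"
  unfolding unit_vector_products_def by (auto intro!: exI[of _ "[v]"])

text \<open>Moving a factor from the front to the back is a conjugation by it.\<close>

lemma is_D6_versor_cyclic:
  assumes "V \<in> unit_vector_products" and "is_D6_versor (V * W)"
  shows "is_D6_versor (W * V)"
proof -
  obtain vs where vs: "V = prod_list (map cvec vs)" "\<forall>v\<in>set vs. norm v = 1"
    using assms(1) by (auto simp: unit_vector_products_def)
  have "is_D6_versor (prod_list (map cvec vs) * W) \<Longrightarrow> is_D6_versor (W * prod_list (map cvec vs))"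
    using vs(2)
  proof (induction vs arbitrary: W)
    case Nil
    then show ?case by simp
  next
    case (Cons a vs)
    then have a: "norm a = 1" by simp
    have "cvec a * (cvec a * (prod_list (map cvec vs) * W)) * cvec a =
        prod_list (map cvec vs) * (W * cvec a)"
      using cvec_unit[OF a] by (simp add: mult.assoc[symmetric])
    moreover have "is_D6_versor (cvec a * (cvec a * (prod_list (map cvec vs) * W)) * cvec a)"
      using Cons.prems(1) by (intro is_D6_versor_conj[OF a]) (simp add: mult.assoc)
    ultimately have "is_D6_versor (W * cvec a * prod_list (map cvec vs))"
      using Cons.IH[of "W * cvec a"] Cons.prems(2) by simp
    then show ?case
      by (simp add: mult.assoc)
  qed
  then show ?thesis
    using assms(2) vs(1) by simp
qed

definition commute_up_to_sign :: "'a::ring_1 \<Rightarrow> 'a \<Rightarrow> bool" where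
  "commute_up_to_sign x y \<longleftrightarrow> x * y = y * x \<or> x * y = - (y * x)"

lemma commute_up_to_sign_mult_left:
  assumes "commute_up_to_sign x z" "commute_up_to_sign y z"
  shows "commute_up_to_sign (x * y) z"
proof -
  have "x * y * z = x * (y * z)" "z * (x * y) = z * x * y" "x * (z * y) = x * z * y"
    by (simp_all only: mult.assoc)
  then show ?thesis
    using assms unfolding commute_up_to_sign_def by fastforce
qed

lemma commute_up_to_sign_sym: "commute_up_to_sign x y \<Longrightarrow> commute_up_to_sign y x"
  by (auto simp: commute_up_to_sign_def)

lemma commute_up_to_sign_prod_list:
  "(\<And>z. z \<in> set zs \<Longrightarrow> commute_up_to_sign x z) \<Longrightarrow> commute_up_to_sign x (prod_list zs)"
proof (induction zs)
  case Nil
  then show ?case by (simp add: commute_up_to_sign_def)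
next
  case (Cons z zs)
  then show ?case
    using commute_up_to_sign_mult_left commute_up_to_sign_sym
    by (metis list.set_intros(1,2) prod_list.Cons)
qed

text \<open>
  The Coxeter elements of a tree diagram are all conjugate. The inductive argument removes one
  leaf after the other; here it is phrased for products in a ring, up to sign because
  orthogonal vectors anticommute.
\<close>

locale cyclic_predicate =
  fixes P :: "'a::ring_1 \<Rightarrow> bool" and G :: "'a set"
  assumes one: "1 \<in> G" and mult: "x \<in> G \<Longrightarrow> y \<in> G \<Longrightarrow> x * y \<in> G"
    and cyclic: "x \<in> G \<Longrightarrow> P (x * y) \<Longrightarrow> P (y * x)"
    and minus: "P x \<Longrightarrow> P (- x)"
begin

lemma minus_iff: "P (- x) \<longleftrightarrow> P x"
  using minus[of x] minus[of "- x"] by auto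

lemma prod_list_in: "set xs \<subseteq> G \<Longrightarrow> prod_list xs \<in> G"
  by (induction xs) (auto intro: one mult)

definition all_orders :: "'a multiset \<Rightarrow> bool" where
  "all_orders M \<longleftrightarrow> (\<forall>ys. mset ys = M \<longrightarrow> P (prod_list ys))"

lemma all_ordersD: "all_orders M \<Longrightarrow> mset ys = M \<Longrightarrow> P (prod_list ys)"
  by (simp add: all_orders_def)

lemma all_orders_single: "all_orders {#w#} \<longleftrightarrow> P w"
  by (auto simp: all_orders_def)

text \<open>
  The factor \<open>x\<close> is a leaf attached to \<open>y\<close>. It can be moved next to \<open>y\<close>, to the left of it, without
  meeting \<open>y\<close>: directly if \<open>y\<close> comes later, and otherwise around the cycle. From then on \<open>x * y\<close>
  is treated as one factor.
\<close>

lemma all_orders_merge: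
  assumes merged: "all_orders (add_mset (x * y) R)"
    and G: "x \<in> G" "y \<in> G" "set_mset R \<subseteq> G"
    and comm: "\<And>z. z \<in># R \<Longrightarrow> commute_up_to_sign x z"
  shows "all_orders (add_mset x (add_mset y R))"
  unfolding all_orders_def
proof (intro allI impI)
  fix ys assume ys: "mset ys = add_mset x (add_mset y R)"
  then have "x \<in> set ys"
    by (metis set_mset_mset union_single_eq_member)
  then obtain p q where pq: "ys = p @ x # q"
    by (meson split_list)
  have pqR: "mset p + mset q = add_mset y R"
    using ys by (simp add: pq)
  then have "y \<in> set p \<or> y \<in> set q"
    by (metis set_mset_mset union_iff union_single_eq_member)
  then show "P (prod_list ys)"
  proof
    assume "y \<in> set q"
    then obtain q1 q2 where q: "q = q1 @ y # q2"
      by (meson split_list)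
    have "mset p + (mset q1 + mset q2) = R"
      using pqR by (simp add: q)
    note R = this[symmetric]
    have "P (prod_list (p @ q1 @ [x * y] @ q2))"
      by (rule all_ordersD[OF merged]) (simp add: R)
    moreover have "commute_up_to_sign x (prod_list q1)"
      by (rule commute_up_to_sign_prod_list) (simp add: comm R)
    then have "x * prod_list q1 = prod_list q1 * x \<or> x * prod_list q1 = - (prod_list q1 * x)"
      by (simp add: commute_up_to_sign_def)
    then have "prod_list ys = prod_list (p @ q1 @ [x * y] @ q2) \<or>
        prod_list ys = - prod_list (p @ q1 @ [x * y] @ q2)"
    proof -
      have e1: "prod_list ys = prod_list p * (x * prod_list q1) * (y * prod_list q2)"
        by (simp add: pq q mult.assoc)
      have e2: "prod_list (p @ q1 @ [x * y] @ q2) =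
          prod_list p * (prod_list q1 * x) * (y * prod_list q2)"
        by (simp add: mult.assoc)
      show ?thesis
        unfolding e1 e2
        using \<open>x * prod_list q1 = prod_list q1 * x \<or> x * prod_list q1 = - (prod_list q1 * x)\<close>
        by (elim disjE) simp_all
    qed
    ultimately show ?thesis
      by (metis minus_iff)
  next
    assume "y \<in> set p"
    then obtain p1 p2 where p: "p = p1 @ y # p2"
      by (meson split_list)
    have "mset q + (mset p1 + mset p2) = R"
      using pqR by (simp add: p ac_simps)
    note R = this[symmetric]
    have "P (prod_list (q @ p1 @ [x * y] @ p2))"
      by (rule all_ordersD[OF merged]) (simp add: R)
    moreover have "commute_up_to_sign x (prod_list (q @ p1))"
      by (rule commute_up_to_sign_prod_list) (auto simp add: comm R)
    then have comm': "x * (prod_list q * prod_list p1) = prod_list q * prod_list p1 * x \<or>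
        x * (prod_list q * prod_list p1) = - (prod_list q * prod_list p1 * x)"
      by (simp add: commute_up_to_sign_def)
    have "prod_list (q @ p1 @ [x * y] @ p2) = x * prod_list q * prod_list (p1 @ y # p2) \<or>
        prod_list (q @ p1 @ [x * y] @ p2) = - (x * prod_list q * prod_list (p1 @ y # p2))"
    proof -
      have e1: "prod_list (q @ p1 @ [x * y] @ p2) = prod_list q * prod_list p1 * x * (y * prod_list p2)"
        by (simp add: mult.assoc)
      have e2: "x * prod_list q * prod_list (p1 @ y # p2) =
          x * (prod_list q * prod_list p1) * (y * prod_list p2)"
        by (simp add: mult.assoc)
      show ?thesis
        unfolding e1 e2 using comm' by (elim disjE) simp_all
    qed
    ultimately have "P (x * prod_list q * prod_list (p1 @ y # p2))"
      by (metis minus_iff)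
    moreover have "x * prod_list q \<in> G"
      using G prod_list_in[of q] R by (intro mult) auto
    ultimately have "P (prod_list (p1 @ y # p2) * (x * prod_list q))"
      by (rule cyclic[rotated])
    then show ?thesis
      by (simp add: pq p mult.assoc)
  qed
qed

end

interpretation D6: cyclic_predicate is_D6_versor unit_vector_products
  by unfold_locales
    (use unit_vector_products_one unit_vector_products_mult is_D6_versor_cyclic is_D6_versor_minus in blast)+

section \<open>The Coxeter versor\<close>

definition unit_cvec :: "real ^ 'n \<Rightarrow> 'n clifford" where
  "unit_cvec \<alpha> = cvec ((1 / norm \<alpha>) *\<^sub>R \<alpha>)"

lemma versor_eq: "versor \<alpha>s = prod_list (map unit_cvec \<alpha>s)"
  unfolding versor_def unit_cvec_def ..

lemma commute_up_to_sign_unit_cvec: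
  fixes \<alpha> \<beta> :: "real ^ 'n::{finite,linorder}"
  assumes "\<alpha> \<bullet> \<beta> = 0"
  shows "commute_up_to_sign (unit_cvec \<alpha>) (unit_cvec \<beta>)"
proof -
  have "orthogonal ((1 / norm \<beta>) *\<^sub>R \<beta>) ((1 / norm \<alpha>) *\<^sub>R \<alpha>)"
    using assms by (simp add: orthogonal_def inner_commute)
  then show ?thesis
    unfolding unit_cvec_def commute_up_to_sign_def by (metis cvec_orthogonal)
qed

lemma conj_unit_cvec_mult:
  fixes \<alpha> v :: "real ^ 'n::{finite,linorder}"
  assumes "\<alpha> \<bullet> \<alpha> = 2"
  shows "reversal (unit_cvec \<alpha> * W) * cvec v * (unit_cvec \<alpha> * W) =
    reversal W * cvec ((\<alpha> \<bullet> v) *\<^sub>R \<alpha> - v) * W"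
proof -
  have sq: "norm \<alpha> * norm \<alpha> = 2"
    using assms by (simp add: dot_square_norm power2_eq_square)
  then have "norm ((1 / norm \<alpha>) *\<^sub>R \<alpha>) = 1"
    by auto
  then have "unit_cvec \<alpha> * cvec v * unit_cvec \<alpha> = cvec ((\<alpha> \<bullet> v) *\<^sub>R \<alpha> - v)"
    unfolding unit_cvec_def using sq by (simp add: cvec_conj)
  then show ?thesis
    unfolding reversal_conj_mult by (simp add: unit_cvec_def reversal_cvec)
qed

lemma norm_unit_cvec: "\<alpha> \<bullet> \<alpha> = 2 \<Longrightarrow> norm ((1 / norm \<alpha>) *\<^sub>R \<alpha>) = 1"
  by auto

text \<open>
  The two roots at the fork change the signs of \<open>f 4\<close> and \<open>f 5\<close>, and the remaining four permute
  \<open>f 0, ..., f 4\<close> cyclically up to sign.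
\<close>

lemma standard_coxeter_versor:
  fixes f :: "nat \<Rightarrow> real ^ 'n::{finite,linorder}"
  assumes dim: "CARD('n) = 6" and f: "orthonormal_frame 6 f"
  shows "is_D6_versor (unit_cvec (f 4 - f 5) * unit_cvec (f 4 + f 5) * unit_cvec (f 3 - f 4) *
    unit_cvec (f 2 - f 3) * unit_cvec (f 1 - f 2) * unit_cvec (f 0 - f 1))" (is "is_D6_versor ?W")
proof -
  note inner = inner_add_left inner_add_right inner_diff_left inner_diff_right
    orthonormal_frame_inner[OF f]
  have W: "?W = unit_cvec (f 4 - f 5) * (unit_cvec (f 4 + f 5) * (unit_cvec (f 3 - f 4) *
      (unit_cvec (f 2 - f 3) * (unit_cvec (f 1 - f 2) * (unit_cvec (f 0 - f 1) * 1)))))"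
    by (simp add: mult.assoc)
  have norms: "(f 4 - f 5) \<bullet> (f 4 - f 5) = 2" "(f 4 + f 5) \<bullet> (f 4 + f 5) = 2"
    "(f 3 - f 4) \<bullet> (f 3 - f 4) = 2" "(f 2 - f 3) \<bullet> (f 2 - f 3) = 2"
    "(f 1 - f 2) \<bullet> (f 1 - f 2) = 2" "(f 0 - f 1) \<bullet> (f 0 - f 1) = 2"
    by (simp_all add: inner)
  have unit: "?W \<in> unit_versors"
    by (intro unit_versors_mult; unfold unit_cvec_def; intro unit_versors_cvec norm_unit_cvec norms)
  note conj = W norms[THEN conj_unit_cvec_mult]
  show ?thesis
  proof (rule signed_cycle_imp_D6_versor[OF dim f unit])
    fix k :: nat assume "k < 4"
    then consider "k = 0" | "k = 1" | "k = 2" | "k = 3" by linarith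
    then show "reversal ?W * cvec (f k) * ?W = cvec (f (Suc k))"
      by cases (unfold conj, simp_all add: inner reversal_one numeral_2_eq_2[symmetric])
  next
    show "reversal ?W * cvec (f 4) * ?W = cvec (- f 0)"
      unfolding conj by (simp add: inner reversal_one)
    show "reversal ?W * cvec (f 5) * ?W = cvec (- f 5)"
      unfolding conj by (simp add: inner reversal_one)
  qed
qed

proposition D6_coxeter_versor:
  fixes \<alpha>s :: "(real ^ 'n::{finite,linorder}) list"
  assumes dim: "CARD('n) = 6" and simple: "simple_system D_roots (set \<alpha>s)" and "distinct \<alpha>s"
  shows "is_D6_versor (versor \<alpha>s)"
proof -
  obtain f where f: "orthonormal_frame 6 f"
    and roots: "set \<alpha>s = D_simple_root 6 f ` {..<6}" and card: "card (set \<alpha>s) = 6"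
    using D_simple_system[OF simple] dim by auto
  have range: "{..<6} = set [0, 1, 2, 3, 4, 5 :: nat]"
    by auto
  define \<beta>s where "\<beta>s = map (D_simple_root 6 f) [0, 1, 2, 3, 4, 5]"
  have set: "set \<alpha>s = set \<beta>s"
    unfolding roots range \<beta>s_def by simp
  moreover have "distinct \<beta>s"
    by (rule card_distinct) (use card set in \<open>simp add: \<beta>s_def\<close>)
  ultimately have "mset \<alpha>s = mset \<beta>s"
    using \<open>distinct \<alpha>s\<close> set_eq_iff_mset_eq_distinct by blast
  then have letters: "mset (map unit_cvec \<alpha>s) = mset (map unit_cvec \<beta>s)"
    by simp
  have "\<beta>s = [f 0 - f 1, f 1 - f 2, f 2 - f 3, f 3 - f 4, f 4 - f 5, f 4 + f 5]"
    by (simp add: \<beta>s_def D_simple_root_def numeral_2_eq_2[symmetric])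
  note letters = letters[unfolded this list.map]
  note inner = inner_add_left inner_add_right inner_diff_left inner_diff_right
    orthonormal_frame_inner[OF f]
  have G: "unit_cvec (f i - f j) \<in> unit_vector_products" "unit_cvec (f i + f j) \<in> unit_vector_products"
    if "i < 6" "j < 6" "i \<noteq> j" for i j
    unfolding unit_cvec_def
    by (intro unit_vector_products_cvec norm_unit_cvec, use that in \<open>simp add: inner\<close>)+
  note comm = commute_up_to_sign_mult_left commute_up_to_sign_unit_cvec
  let ?a = "unit_cvec (f 0 - f 1)" and ?b = "unit_cvec (f 1 - f 2)" and ?c = "unit_cvec (f 2 - f 3)"
    and ?d = "unit_cvec (f 3 - f 4)" and ?r = "unit_cvec (f 4 - f 5)" and ?r' = "unit_cvec (f 4 + f 5)"
  \<comment> \<open>Each step splits off a leaf of the diagram formed by the factors that remain.\<close>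
  have "D6.all_orders {#?r * ?r' * ?d * ?c * ?b * ?a#}"
    unfolding D6.all_orders_single by (rule standard_coxeter_versor[OF dim f])
  then have "D6.all_orders {#?r * ?r' * ?d * ?c * ?b, ?a#}"
    by (rule D6.all_orders_merge) (auto intro!: G unit_vector_products_mult)
  then have "D6.all_orders {#?r * ?r' * ?d * ?c, ?b, ?a#}"
    by (rule D6.all_orders_merge) (auto intro!: G unit_vector_products_mult comm simp: inner)
  then have "D6.all_orders {#?r * ?r' * ?d, ?c, ?b, ?a#}"
    by (rule D6.all_orders_merge) (auto intro!: G unit_vector_products_mult comm simp: inner)
  then have "D6.all_orders {#?r * (?r' * ?d), ?c, ?b, ?a#}"
    by (simp only: mult.assoc)
  then have "D6.all_orders {#?r, ?r' * ?d, ?c, ?b, ?a#}"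
    by (rule D6.all_orders_merge) (auto intro!: G unit_vector_products_mult comm simp: inner)
  then have "D6.all_orders {#?r' * ?d, ?r, ?c, ?b, ?a#}"
    by (simp only: add_mset_commute)
  then have "D6.all_orders {#?r', ?d, ?r, ?c, ?b, ?a#}"
    by (rule D6.all_orders_merge) (auto intro!: G unit_vector_products_mult comm simp: inner)
  moreover have "mset (map unit_cvec \<alpha>s) = {#?r', ?d, ?r, ?c, ?b, ?a#}"
    unfolding letters by simp
  ultimately show ?thesis
    unfolding D6.all_orders_def versor_eq by blast
qed

section \<open>The characteristic polynomial from an eigenbasis\<close>

text \<open>
  With the eigenvectors as columns of \<open>Q\<close>, \<open>(X - A) Q = Q (X - D)\<close> holds over the polynomial ring,
  and the determinant of \<open>Q\<close> can be cancelled there.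
\<close>

lemma complex_charpoly_eigenbasis:
  fixes w :: "real ^ 'n \<Rightarrow> real ^ 'n" and Q :: "complex ^ 'n ^ 'n"
  assumes eigen: "\<And>r c. (\<Sum>k\<in>UNIV. complex_of_real (matrix w $ r $ k) * Q $ k $ c) = l c * Q $ r $ c"
    and det: "det Q \<noteq> 0"
  shows "complex_charpoly w = (\<Prod>c\<in>UNIV. [:- l c, 1:])"
proof -
  define A :: "complex poly ^ 'n ^ 'n" where
    "A = (\<chi> i j. (if i = j then [:0, 1:] else 0) - [:complex_of_real (matrix w $ i $ j):])"
  define Q' :: "complex poly ^ 'n ^ 'n" where "Q' = (\<chi> i j. [:Q $ i $ j:])"
  define D :: "complex poly ^ 'n ^ 'n" where "D = (\<chi> i j. if i = j then [:- l j, 1:] else 0)"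
  have "A ** Q' = Q' ** D"
  proof -
    have "(A ** Q') $ r $ c = (Q' ** D) $ r $ c" for r c
    proof -
      have "(A ** Q') $ r $ c = (\<Sum>k\<in>UNIV. (if r = k then [:0, 1:] * [:Q $ k $ c:] else 0)
          - [:complex_of_real (matrix w $ r $ k) * Q $ k $ c:])"
        unfolding matrix_matrix_mult_def A_def Q'_def by (auto intro!: sum.cong simp: left_diff_distrib)
      also have "\<dots> = [:0, 1:] * [:Q $ r $ c:] - (\<Sum>k\<in>UNIV. [:complex_of_real (matrix w $ r $ k) * Q $ k $ c:])"
        by (simp add: sum_subtractf)
      also have "(\<Sum>k\<in>UNIV. [:complex_of_real (matrix w $ r $ k) * Q $ k $ c:]) =
          [:\<Sum>k\<in>UNIV. complex_of_real (matrix w $ r $ k) * Q $ k $ c:]"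
        by (rule poly_eqI) (simp add: coeff_sum coeff_pCons split: nat.splits)
      also have "[:0, 1:] * [:Q $ r $ c:] - [:\<Sum>k\<in>UNIV. complex_of_real (matrix w $ r $ k) * Q $ k $ c:] =
          [:Q $ r $ c:] * [:- l c, 1:]"
        unfolding eigen by simp
      also have "\<dots> = (Q' ** D) $ r $ c"
        unfolding matrix_matrix_mult_def Q'_def D_def
        by (simp add: if_distrib[of "\<lambda>t. _ * t"] cong: if_cong)
      finally show ?thesis .
    qed
    then show ?thesis by (simp add: vec_eq_iff)
  qed
  then have "det A * det Q' = det Q' * det D"
    by (metis det_mul)
  moreover have "det Q' \<noteq> 0"
  proof
    assume "det Q' = 0"
    then have "poly (det Q') 0 = 0" by simp
    moreover have "poly (det Q') 0 = det Q"
      by (simp add: det_def poly_sum poly_prod Q'_def of_int_poly)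
    ultimately show False using det by simp
  qed
  ultimately have "det A = det D"
    by (simp add: mult.commute)
  also have "\<dots> = (\<Prod>c\<in>UNIV. [:- l c, 1:])"
    by (subst det_diagonal) (simp_all add: D_def)
  finally show ?thesis
    by (simp add: complex_charpoly_def A_def)
qed

lemma orthonormal_columns_det:
  fixes Q :: "complex ^ 'n ^ 'n"
  assumes "\<And>a b. (\<Sum>k\<in>UNIV. cnj (Q $ k $ a) * Q $ k $ b) = (if a = b then 1 else 0)"
  shows "det Q \<noteq> 0"
proof -
  have "(\<chi> i j. cnj (Q $ j $ i)) ** Q = mat 1"
    unfolding matrix_matrix_mult_def mat_def using assms by (simp add: vec_eq_iff)
  then have "det (\<chi> i j. cnj (Q $ j $ i)) * det Q = 1"
    by (metis det_mul det_I)
  then show ?thesis by auto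
qed

definition complex_vector :: "real ^ 'n \<Rightarrow> real ^ 'n \<Rightarrow> complex ^ 'n" where
  "complex_vector u v = (\<chi> k. Complex (u $ k) (v $ k))"

lemma hermitian_product:
  "(\<Sum>k\<in>UNIV. cnj (complex_vector u v $ k) * complex_vector x y $ k) =
    Complex (u \<bullet> x + v \<bullet> y) (u \<bullet> y - v \<bullet> x)"
  by (simp add: complex_vector_def complex_eq_iff inner_vec_def sum.distrib sum_subtractf mult.commute
      algebra_simps)

lemma matrix_complex_vector:
  assumes "linear w"
  shows "(\<Sum>k\<in>UNIV. complex_of_real (matrix w $ r $ k) * complex_vector u v $ k) =
    complex_vector (w u) (w v) $ r"
proof -
  have "w x = matrix w *v x" for x
    using assms by (simp add: matrix_works)
  then have "w x $ r = (\<Sum>k\<in>UNIV. matrix w $ r $ k * x $ k)" for x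
    by (simp add: matrix_vector_mult_def)
  then show ?thesis
    by (simp add: complex_vector_def complex_eq_iff)
qed

section \<open>Coxeter number, Coxeter plane and exponents\<close>

lemma cis_tenth: "exp (2 * of_real pi * \<i> * of_nat m / of_nat 10) = cis (real m * pi / 5)"
  by (simp add: cis_conv_exp field_simps)

locale D6_rotation =
  fixes w :: "real ^ 'n \<Rightarrow> real ^ 'n" and u :: "nat \<Rightarrow> real ^ 'n"
  assumes dim: "CARD('n) = 6" and frame: "orthonormal_frame 6 u" and linear: "linear w"
    and w: "w (u 0) = cos (pi / 5) *\<^sub>R u 0 + sin (pi / 5) *\<^sub>R u 1"
      "w (u 1) = - sin (pi / 5) *\<^sub>R u 0 + cos (pi / 5) *\<^sub>R u 1"
      "w (u 2) = cos (3 * pi / 5) *\<^sub>R u 2 + sin (3 * pi / 5) *\<^sub>R u 3"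
      "w (u 3) = - sin (3 * pi / 5) *\<^sub>R u 2 + cos (3 * pi / 5) *\<^sub>R u 3"
      "w (u 4) = - u 4" "w (u 5) = - u 5"
begin

lemmas w_lin = linear_add[OF linear] linear_diff[OF linear] linear_scale[OF linear] linear_neg[OF linear]

lemma rotation_power:
  assumes "w p = cos t *\<^sub>R p + sin t *\<^sub>R q" "w q = - sin t *\<^sub>R p + cos t *\<^sub>R q"
  shows "(w ^^ k) p = cos (real k * t) *\<^sub>R p + sin (real k * t) *\<^sub>R q"
    and "(w ^^ k) q = - sin (real k * t) *\<^sub>R p + cos (real k * t) *\<^sub>R q"
proof (induction k)
  case 0
  show "(w ^^ 0) p = cos (real 0 * t) *\<^sub>R p + sin (real 0 * t) *\<^sub>R q"
    "(w ^^ 0) q = - sin (real 0 * t) *\<^sub>R p + cos (real 0 * t) *\<^sub>R q"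
    by simp_all
next
  case (Suc k)
  have angle: "real (Suc k) * t = real k * t + t"
    by (simp add: distrib_right)
  have "(w ^^ Suc k) p = cos (real k * t) *\<^sub>R (cos t *\<^sub>R p + sin t *\<^sub>R q) +
      sin (real k * t) *\<^sub>R (- sin t *\<^sub>R p + cos t *\<^sub>R q)"
    unfolding funpow.simps comp_apply Suc.IH w_lin assms ..
  then show "(w ^^ Suc k) p = cos (real (Suc k) * t) *\<^sub>R p + sin (real (Suc k) * t) *\<^sub>R q"
    unfolding angle cos_add sin_add by (simp add: algebra_simps)
  have "(w ^^ Suc k) q = - sin (real k * t) *\<^sub>R (cos t *\<^sub>R p + sin t *\<^sub>R q) +
      cos (real k * t) *\<^sub>R (- sin t *\<^sub>R p + cos t *\<^sub>R q)"
    unfolding funpow.simps comp_apply Suc.IH w_lin assms ..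
  then show "(w ^^ Suc k) q = - sin (real (Suc k) * t) *\<^sub>R p + cos (real (Suc k) * t) *\<^sub>R q"
    unfolding angle cos_add sin_add by (simp add: algebra_simps)
qed

lemma negation_power: "w p = - p \<Longrightarrow> (w ^^ k) p = (-1) ^ k *\<^sub>R p"
  by (induction k) (simp_all add: w_lin)

lemma coxeter_number_10: "coxeter_number w = 10"
  unfolding coxeter_number_def
proof (rule Least_equality)
  have lin: "linear (w ^^ k)" for k
  proof (induction k)
    case 0
    then show ?case by (simp add: linear_id[unfolded id_def])
  next
    case (Suc k)
    then show ?case using linear_compose[OF Suc linear] by (simp only: funpow.simps)
  qed
  have "cos (10 * (pi / 5)) = 1" "sin (10 * (pi / 5)) = 0" "cos (10 * (3 * pi / 5)) = 1" "sin (10 * (3 * pi / 5)) = 0"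
    using cos_one_2pi_int[of "10 * (3 * pi / 5)"] sin_npi[of 6] cos_npi[of 6] by simp_all
  then have "\<forall>k<6. (w ^^ 10) (u k) = id (u k)"
    unfolding all_less_6
    using rotation_power[OF w(1,2), of 10] rotation_power[OF w(3,4), of 10]
      negation_power[OF w(5), of 10] negation_power[OF w(6), of 10] by simp
  then have "(w ^^ 10) x = id x" for x
    using linear_eq_on[OF lin linear_id, of x "u ` {..<6}" 10] orthonormal_frame_span[of u] frame dim
    by auto
  then show "0 < (10 :: nat) \<and> w ^^ 10 = id" by auto
next
  fix n :: nat assume n: "0 < n \<and> w ^^ n = id"
  then have "u 0 = cos (real n * (pi / 5)) *\<^sub>R u 0 + sin (real n * (pi / 5)) *\<^sub>R u 1"
    using rotation_power(1)[OF w(1,2), of n] by simp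
  then have "u 0 \<bullet> u 0 = (cos (real n * (pi / 5)) *\<^sub>R u 0 + sin (real n * (pi / 5)) *\<^sub>R u 1) \<bullet> u 0"
    by simp
  then have "cos (real n * (pi / 5)) = 1"
    using orthonormal_frame_inner[OF frame] by (simp add: inner_add_left)
  then obtain m :: int where "real n * (pi / 5) = real_of_int m * 2 * pi"
    unfolding cos_one_2pi_int by blast
  then have "real_of_int (int n) = real_of_int (10 * m)"
    by (simp add: field_simps)
  then have "int n = 10 * m"
    by (simp only: of_int_eq_iff)
  moreover have "0 < n" using n by simp
  ultimately show "10 \<le> n" by presburger
qed

lemma coxeter_plane: "is_coxeter_plane w (span {u 0, u 1})"
proof -
  have angle: "2 * pi / real (coxeter_number w) = pi / 5"
    by (simp add: coxeter_number_10)
  show ?thesis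
    unfolding is_coxeter_plane_def acts_as_rotation_def angle
    using orthonormal_frameD[OF frame] w(1,2)
    by (intro exI[of _ "u 0"] exI[of _ "u 1"]) simp
qed

text \<open>
  The vector \<open>p - i q\<close> of a plane rotated by \<open>t\<close> from \<open>p\<close> to \<open>q\<close> has eigenvalue \<open>exp (i t)\<close>, and
  \<open>p + i q\<close> the conjugate one; thus a plane contributes exponents \<open>m\<close> and \<open>10 - m\<close>.
\<close>

definition exponent :: "nat \<Rightarrow> nat" where
  "exponent k = [1, 9, 3, 7, 5, 5] ! k"

definition eigenvector :: "nat \<Rightarrow> complex ^ 'n" where
  "eigenvector k = [complex_vector (sqrt (1 / 2) *\<^sub>R u 0) (- sqrt (1 / 2) *\<^sub>R u 1),
     complex_vector (sqrt (1 / 2) *\<^sub>R u 0) (sqrt (1 / 2) *\<^sub>R u 1),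
     complex_vector (sqrt (1 / 2) *\<^sub>R u 2) (- sqrt (1 / 2) *\<^sub>R u 3),
     complex_vector (sqrt (1 / 2) *\<^sub>R u 2) (sqrt (1 / 2) *\<^sub>R u 3),
     complex_vector (u 4) 0, complex_vector (u 5) 0] ! k"

lemma nth_6: "[a0, a1, a2, a3, a4, a5] ! 0 = a0" "[a0, a1, a2, a3, a4, a5] ! 1 = a1"
  "[a0, a1, a2, a3, a4, a5] ! 2 = a2" "[a0, a1, a2, a3, a4, a5] ! 3 = a3"
  "[a0, a1, a2, a3, a4, a5] ! 4 = a4" "[a0, a1, a2, a3, a4, a5] ! 5 = a5"
  by (simp_all add: eval_nat_numeral)

lemma eigenvector_eq:
  "\<forall>k<6. \<forall>r. (\<Sum>i\<in>UNIV. complex_of_real (matrix w $ r $ i) * eigenvector k $ i) =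
    cis (real (exponent k) * pi / 5) * eigenvector k $ r"
proof -
  have "cos (9 * pi / 5) = cos (2 * pi - pi / 5)" "sin (9 * pi / 5) = sin (2 * pi - pi / 5)"
    "cos (7 * pi / 5) = cos (2 * pi - 3 * pi / 5)" "sin (7 * pi / 5) = sin (2 * pi - 3 * pi / 5)"
    by (simp_all add: field_simps)
  then have trig: "cos (9 * pi / 5) = cos (pi / 5)" "sin (9 * pi / 5) = - sin (pi / 5)"
    "cos (7 * pi / 5) = cos (3 * pi / 5)" "sin (7 * pi / 5) = - sin (3 * pi / 5)"
    by (simp_all only: cos_2pi_minus sin_2pi_minus)
  have w0: "w 0 = 0" using linear by (rule linear_0)
  show ?thesis
    unfolding all_less_6 eigenvector_def exponent_def nth_6 matrix_complex_vector[OF linear]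
    by (simp add: complex_vector_def complex_eq_iff w w_lin w0 trig
        trig[unfolded mult.commute[of _ pi]] algebra_simps del: One_nat_def)
qed

lemma eigenvector_orthonormal:
  "\<forall>a<6. \<forall>b<6. (\<Sum>k\<in>UNIV. cnj (eigenvector a $ k) * eigenvector b $ k) = (if a = b then 1 else 0)"
  unfolding all_less_6 eigenvector_def nth_6 hermitian_product
  by (simp add: orthonormal_frame_inner[OF frame] complex_eq_iff)

text \<open>
  The columns of a matrix over \<open>'n\<close> are indexed by \<open>'n\<close>, whence the transport along a bijection with
  the first six numbers.
\<close>

lemma complex_charpoly: "complex_charpoly w = (\<Prod>k<6. [:- cis (real (exponent k) * pi / 5), 1:])"
proof -
  obtain idx :: "'n \<Rightarrow> nat" where idx: "bij_betw idx UNIV {..<6}"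
    using dim finite_same_card_bij[of "UNIV :: 'n set" "{..<6::nat}"] by auto
  then have less: "idx c < 6" and inj: "idx a = idx b \<longleftrightarrow> a = b" for a b c
    by (auto simp: bij_betw_def inj_on_def)
  have "complex_charpoly w = (\<Prod>c\<in>UNIV. [:- cis (real (exponent (idx c)) * pi / 5), 1:])"
  proof (rule complex_charpoly_eigenbasis[where Q = "\<chi> r c. eigenvector (idx c) $ r"])
    show "(\<Sum>k\<in>UNIV. complex_of_real (matrix w $ r $ k) * (\<chi> r c. eigenvector (idx c) $ r) $ k $ c) =
        cis (real (exponent (idx c)) * pi / 5) * (\<chi> r c. eigenvector (idx c) $ r) $ r $ c" for r c
      using eigenvector_eq less[of c] by simp
    show "det (\<chi> r c. eigenvector (idx c) $ r) \<noteq> 0"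
      by (rule orthonormal_columns_det) (simp add: eigenvector_orthonormal less inj)
  qed
  also have "\<dots> = (\<Prod>k<6. [:- cis (real (exponent k) * pi / 5), 1:])"
    by (rule prod.reindex_bij_betw[OF idx])
  finally show ?thesis .
qed

lemma exponents: "exponents w = {#1, 3, 5, 5, 7, 9#}"
proof -
  have "exponents w = (\<Sum>m\<in>{0<..<10}. replicate_mset (count {#1, 3, 5, 5, 7, 9#} m) m)"
    unfolding exponents_def coxeter_number_10
  proof (intro sum.cong refl arg_cong2[where f = replicate_mset])
    fix m :: nat assume m: "m \<in> {0<..<10}"
    have inj: "cis (real (exponent k) * pi / 5) = cis (real m * pi / 5) \<longleftrightarrow> exponent k = m"
      if "k < 6" for k
    proof -
      have "\<forall>k<6. exponent k < 10"
        unfolding all_less_6 exponent_def nth_6 by simp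
      then have e: "exponent k < 10" using that by blast
      show ?thesis
        unfolding cis_tenth[symmetric] by (subst complex_root_unity_eq) (use e m in simp_all)
    qed
    have "order (cis (real m * pi / 5)) (complex_charpoly w) =
        count (proots (complex_charpoly w)) (cis (real m * pi / 5))"
      by (rule count_proots[symmetric]) (simp add: complex_charpoly)
    also have "\<dots> = (\<Sum>k<6. if cis (real (exponent k) * pi / 5) = cis (real m * pi / 5) then 1 else 0)"
      unfolding complex_charpoly by (subst proots_prod) (auto simp: count_sum intro!: sum.cong)
    also have "\<dots> = (\<Sum>k<6. if exponent k = m then 1 else 0)"
      by (intro sum.cong refl) (simp add: inj)
    also have "\<dots> = count {#1, 3, 5, 5, 7, 9#} m"
    proof -
      have "{..<6} = {0, 1, 2, 3, 4, 5 :: nat}" by auto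
      then show ?thesis by (simp add: exponent_def eval_nat_numeral)
    qed
    finally show "order (exp (2 * of_real pi * \<i> * of_nat m / of_nat 10)) (complex_charpoly w) =
        count {#1, 3, 5, 5, 7, 9#} m"
      unfolding cis_tenth .
  qed
  also have "\<dots> = {#1, 3, 5, 5, 7, 9#}"
  proof -
    have "{0<..<10} = {1, 2, 3, 4, 5, 6, 7, 8, 9 :: nat}" by auto
    then show ?thesis by (simp add: numeral_2_eq_2)
  qed
  finally show ?thesis .
qed

end

section \<open>The decomposition of the versor\<close>

lemma is_unit_bivector_frame:
  fixes u :: "nat \<Rightarrow> real ^ 'n::{finite,linorder}"
  assumes "orthonormal_frame n u" "i < n" "j < n" "i \<noteq> j"
  shows "is_unit_bivector (span {u i, u j}) (cvec (u i) * cvec (u j))"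
  unfolding is_unit_bivector_def using orthonormal_frameD[OF assms(1)] assms(2-4) by blast

lemma orthogonal_subspaces_frame:
  assumes "orthonormal_frame n u" "{i, j, k, l} \<subseteq> {..<n}" "{i, j} \<inter> {k, l} = {}"
  shows "orthogonal_subspaces (span {u i, u j}) (span {u k, u l})"
  unfolding orthogonal_subspaces_def
proof (intro ballI)
  fix x y assume x: "x \<in> span {u i, u j}" and y: "y \<in> span {u k, u l}"
  have "orthogonal a y" if "a \<in> {u i, u j}" for a
    using y by (rule orthogonal_to_span) (use that assms orthonormal_frameD(2)[OF assms(1)] in auto)
  then have "orthogonal y x"
    by (intro orthogonal_to_span[OF x]) (simp add: orthogonal_commute)
  then show "orthogonal x y"
    by (simp add: orthogonal_commute)
qed

lemma D6_versor_rotation: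
  fixes u :: "nat \<Rightarrow> real ^ 'n::{finite,linorder}"
  assumes dim: "CARD('n) = 6" and u: "orthonormal_frame 6 u"
  shows "D6_rotation (sandwich (D6_versor u)) u"
proof -
  note action = D6_versor_action[OF u]
  have span: "span (u ` {..<6}) = UNIV"
    using orthonormal_frame_span[of u] u dim by simp
  have "\<forall>k<6. \<exists>x. reversal (D6_versor u) * cvec (u k) * D6_versor u = cvec x"
    unfolding all_less_6 using action by blast
  then have "linear (sandwich (D6_versor u))"
    by (intro sandwich_on_spanning_set(2)[OF span]) auto
  then show ?thesis
    by (intro D6_rotation.intro dim u action(2-7)[THEN sandwich_eqI])
qed

theorem mainTheorem6:
  fixes \<alpha>s :: "(real ^ 6) list"
  assumes "simple_system D_roots (set \<alpha>s)" and "distinct \<alpha>s"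
  shows "(\<exists>P\<^sub>C P\<^sub>2 P\<^sub>3 B\<^sub>C B\<^sub>2 B\<^sub>3.
            is_unit_bivector P\<^sub>C B\<^sub>C \<and> is_unit_bivector P\<^sub>2 B\<^sub>2 \<and> is_unit_bivector P\<^sub>3 B\<^sub>3 \<and>
            orthogonal_subspaces P\<^sub>C P\<^sub>2 \<and> orthogonal_subspaces P\<^sub>C P\<^sub>3 \<and>
            orthogonal_subspaces P\<^sub>2 P\<^sub>3 \<and>
            is_coxeter_plane (sandwich (versor \<alpha>s)) P\<^sub>C \<and>
            versor \<alpha>s = cl_exp ((pi / 10) *\<^sub>R B\<^sub>C) * cl_exp ((3 * pi / 10) *\<^sub>R B\<^sub>2) * B\<^sub>3) \<and>
         exponents (sandwich (versor \<alpha>s)) = {#1, 3, 5, 5, 7, 9#}"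
proof -
  have dim: "CARD(6) = 6" by simp
  obtain u :: "nat \<Rightarrow> real ^ 6" where u: "orthonormal_frame 6 u" and W: "versor \<alpha>s = D6_versor u"
    using D6_coxeter_versor[OF dim assms] unfolding is_D6_versor_def by blast
  interpret D6_rotation "sandwich (versor \<alpha>s)" u
    unfolding W using dim u by (rule D6_versor_rotation)
  show ?thesis
  proof (intro conjI exI)
    show "is_unit_bivector (span {u 0, u 1}) (cvec (u 0) * cvec (u 1))"
      "is_unit_bivector (span {u 2, u 3}) (cvec (u 2) * cvec (u 3))"
      "is_unit_bivector (span {u 4, u 5}) (cvec (u 4) * cvec (u 5))"
      by (rule is_unit_bivector_frame[OF u]; simp)+
    show "orthogonal_subspaces (span {u 0, u 1}) (span {u 2, u 3})"
      "orthogonal_subspaces (span {u 0, u 1}) (span {u 4, u 5})"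
      "orthogonal_subspaces (span {u 2, u 3}) (span {u 4, u 5})"
      by (rule orthogonal_subspaces_frame[OF u]; simp)+
    show "is_coxeter_plane (sandwich (versor \<alpha>s)) (span {u 0, u 1})"
      by (rule coxeter_plane)
    show "versor \<alpha>s = cl_exp ((pi / 10) *\<^sub>R (cvec (u 0) * cvec (u 1))) *
        cl_exp ((3 * pi / 10) *\<^sub>R (cvec (u 2) * cvec (u 3))) * (cvec (u 4) * cvec (u 5))"
      unfolding W D6_versor_def ..
    show "exponents (sandwich (versor \<alpha>s)) = {#1, 3, 5, 5, 7, 9#}"
      by (rule exponents)
  qed
qed

end
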